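(* Let $A\in\mathbb{C}$ and $f\in L^\infty(\mathbb{R}^{2d})$ be given. The following are equivalent. (a) There is some non-zero Schwartz function $\Phi\in\mathscr{S}(\mathbb{R}^{2d})$ such that for every $R>0$ $$\lim_{|x|\to\infty}\ \sup_{|\omega|\le R}|V_\Phi(f-A)(x,\omega)|=0.$$ (b) There is $a\in W(\mathbb{R}^{2d})$ and $h\in C_0(\mathbb{R}^{2d})$ such that $f\ast a=A\cdot\int_{\mathbb{R}^{2d}}a(z)\,dz+h$. (c) For any $g\in L^1(\mathbb{R}^{2d})$ there is $h_g\in C_0(\mathbb{R}^{2d})$ such that $f\ast g=A\cdot\int_{\mathbb{R}^{2d}}g(z)\,dz+h_g$.
   Context: Here $x,\omega\in\mathbb{R}^{2d}$, and $V_\Phi g(x,\omega)=\int_{\mathbb{R}^{2d}}g(t)\overline{\Phi(t-x)}e^{-2\pi i\omega\cdot t}\,dt$ is the short-time Fourier transform of $g\in L^\infty(\mathbb{R}^{2d})$ with window $\Phi$; $f-A$ denotes $f$ minus the constant function $A$. $W(\mathbb{R}^{2d})$ is the set of $a\in L^1(\mathbb{R}^{2d})$ whose symplectic Fourier transform $\mathcal{F}_\sigma(a)(z)=\int_{\mathbb{R}^{2d}}a(z')e^{-2\pi i\sigma(z,z')}\,dz'$, where $\sigma((x_1,\omega_1),(x_2,\omega_2))=\omega_1\cdot x_2-\omega_2\cdot x_1$, has no zeros on $\mathbb{R}^{2d}$ (equivalently, whose usual Fourier transform has no zeros). *)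

theory Defs
  imports "HOL-Analysis.Analysis"
begin

text \<open>Phase space \<open>\<real>\<^sup>2\<^sup>d\<close> is the product \<open>(real^'d) \<times> (real^'d)\<close>, whose inner product and norm
  are the Euclidean ones. Elements of \<open>L\<^sup>1\<close> and \<open>L\<^sup>\<infinity>\<close> are given by representatives with respect to
  Lebesgue measure; \<open>L\<^sup>1\<close> membership is \<^const>\<open>integrable\<close>.\<close>

type_synonym 'd phase_space = "(real^'d) \<times> (real^'d)"

definition Linfty :: "('a::euclidean_space \<Rightarrow> complex) set" where
  "Linfty = {f \<in> borel_measurable lebesgue. \<exists>C. AE x in lebesgue. norm (f x) \<le> C}"

definition C0 :: "('a::euclidean_space \<Rightarrow> complex) set" where
  "C0 = {h. continuous_on UNIV h \<and> (h \<longlongrightarrow> 0) at_infinity}"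

primrec iter_partial :: "'a::euclidean_space list \<Rightarrow> ('a \<Rightarrow> complex) \<Rightarrow> 'a \<Rightarrow> complex" where
  "iter_partial [] f = f"
| "iter_partial (b # bs) f = (\<lambda>x. frechet_derivative (iter_partial bs f) (at x) b)"

text \<open>A list of basis vectors plays the role of a multi-index. Differentiability of all iterated
  partial derivatives is smoothness; it also guarantees that every
  \<^const>\<open>frechet_derivative\<close> occurring here is a genuine derivative.\<close>

definition Schwartz :: "('a::euclidean_space \<Rightarrow> complex) set" where
  "Schwartz = {\<phi>. \<forall>bs. set bs \<subseteq> Basis \<longrightarrow>
      (\<forall>x. iter_partial bs \<phi> differentiable (at x)) \<and>
      (\<forall>k::nat. bounded (range (\<lambda>x. (1 + norm x) ^ k *\<^sub>R iter_partial bs \<phi> x)))}"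

definition STFT :: "('a::euclidean_space \<Rightarrow> complex) \<Rightarrow> ('a \<Rightarrow> complex) \<Rightarrow> 'a \<Rightarrow> 'a \<Rightarrow> complex" where
  "STFT \<Phi> g x \<omega> =
    (LINT t|lebesgue. g t * cnj (\<Phi> (t - x)) * exp (- 2 * of_real pi * \<i> * of_real (\<omega> \<bullet> t)))"

definition convolution ::
    "('a::euclidean_space \<Rightarrow> complex) \<Rightarrow> ('a \<Rightarrow> complex) \<Rightarrow> 'a \<Rightarrow> complex" where
  "convolution f g z = (LINT z'|lebesgue. f z' * g (z - z'))"

definition symplectic :: "'d::finite phase_space \<Rightarrow> 'd phase_space \<Rightarrow> real" where
  "symplectic z z' = snd z \<bullet> fst z' - snd z' \<bullet> fst z"

definition symplectic_fourier :: "('d::finite phase_space \<Rightarrow> complex) \<Rightarrow> 'd phase_space \<Rightarrow> complex" where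
  "symplectic_fourier a z =
    (LINT z'|lebesgue. a z' * exp (- 2 * of_real pi * \<i> * of_real (symplectic z z')))"

definition Wiener_class :: "('d::finite phase_space \<Rightarrow> complex) set" where
  "Wiener_class = {a. integrable lebesgue a \<and> (\<forall>z. symplectic_fourier a z \<noteq> 0)}"

end

theory Submission
  imports
    Defs
    "HOL-Probability.Characteristic_Functions"
    "HOL-Probability.Sinc_Integral"
    "HOL-Real_Asymp.Real_Asymp"
begin

text \<open>
  Put \<open>F = f - A\<close>. Since \<open>A * g = A \<cdot> \<integral> g\<close>, and since \<open>F * g\<close> is continuous for every integrable \<open>g\<close>, (b) and
  (c) say that \<open>F * g\<close> tends to \<open>0\<close> at infinity, for one \<open>g\<close> or for all of them. Up to a factor of modulus one,
  \<open>V\<^sub>\<Phi> F (x, \<omega>)\<close> is also a convolution, \<open>(F * w\<^sub>\<omega>) (x)\<close>, where \<open>w\<^sub>\<omega>\<close> is the reflected conjugate of \<open>\<Phi>\<close>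
  modulated by \<open>\<omega>\<close> (\<open>norm_STFT\<close>). So everything is about the set \<open>vanishing F\<close> of those \<open>g\<close> in \<open>L\<^sup>1\<close> for which
  \<open>F * g\<close> tends to \<open>0\<close>, which is a closed ideal of the convolution algebra \<open>L\<^sup>1\<close>
  (\<open>closed_L1_ideal_vanishing\<close>).

  Wiener's theorem (\<open>Wiener_tauberian\<close>) says that a closed ideal is all of \<open>L\<^sup>1\<close> if at every frequency some
  element has a nonzero Fourier transform. Under (b) one element serves all frequencies. Under (a) the ideal
  contains every \<open>w\<^sub>\<omega>\<close>; their Fourier transforms are the translates of a single one, which is not identically
  zero because \<open>\<Phi>\<close> is not (\<open>fourier_zero_imp_AE_zero\<close>). Hence both imply (c). Conversely the Gaussian, which is
  a Schwartz function without zeros in its Fourier transform, turns (c) into (b), and also into (a): the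
  convergence is uniform for bounded \<open>\<omega>\<close> because \<open>w\<^sub>\<omega>\<close> is Lipschitz in \<open>\<omega>\<close> with values in \<open>L\<^sup>1\<close>.

  The proof of Wiener's theorem works with functions that are bounded limits of trigonometric polynomials with
  frequencies in a set \<open>S\<close> (\<open>bandlimited S\<close>); convolution with \<open>v\<close> multiplies them by \<open>c\<close> if the Fourier
  transform of \<open>v\<close> is \<open>c\<close> on \<open>S\<close> (\<open>conv_bandlimited\<close>). If \<open>a\<close> is in the ideal, with transform \<open>1\<close> at
  \<open>\<xi>\<close>, then convolution with \<open>a\<close> is so close to the identity on functions with frequencies near \<open>\<xi>\<close>
  that a Neumann iteration puts all of them into the ideal (\<open>local_membership\<close>). A function with frequencies in
  a large ball is multiplied by a Fejer kernel with frequencies in a tiny ball: the trigonometric polynomials that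
  approximate it then become finite sums of functions already treated (\<open>bandlimited_membership\<close>). Finally,
  convolution with an approximate identity of Fejer kernels makes every integrable function a limit of elements of
  the ideal.
\<close>

(* Probability theory has a constant of the same name, for measures. *)
hide_const (open) Convolution.convolution

section \<open>Convolution on \<open>L\<^sup>1\<close>\<close>

definition L1_norm :: "('a::euclidean_space \<Rightarrow> complex) \<Rightarrow> real" where
  "L1_norm g = (LINT x|lborel. norm (g x))"

text \<open>This is \<^const>\<open>Defs.convolution\<close> with Lebesgue measure restricted to the Borel sets. Fubini's theorem is about the
  product sigma-algebra, on which \<open>(w, z) \<mapsto> g (z - w)\<close> is measurable for Borel functions \<open>g\<close>; the theory is
  therefore developed for Borel functions, and Lebesgue measurable ones are replaced by Borel representatives at the
  end.\<close>

definition conv :: "('a::euclidean_space \<Rightarrow> complex) \<Rightarrow> ('a \<Rightarrow> complex) \<Rightarrow> 'a \<Rightarrow> complex" where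
  "conv f g z = (LINT w|lborel. f w * g (z - w))"

text \<open>The normalisation without \<open>2 \<pi>\<close> in the exponent.\<close>

definition fourier :: "('a::euclidean_space \<Rightarrow> complex) \<Rightarrow> 'a \<Rightarrow> complex" where
  "fourier a \<xi> = (LINT x|lborel. a x * cis (- (\<xi> \<bullet> x)))"

lemma integrable_affine:
  fixes f :: "'a::euclidean_space \<Rightarrow> 'b::{banach, second_countable_topology}"
  assumes f: "integrable lborel f" and c: "c \<noteq> 0"
  shows "integrable lborel (\<lambda>x. f (t + c *\<^sub>R x))"
proof -
  have [measurable]: "f \<in> borel_measurable borel"
    using f by (simp add: integrable_iff_bounded)
  have "integrable (density (distr lborel borel (\<lambda>x. t + c *\<^sub>R x)) (\<lambda>_. \<bar>c\<bar>^DIM('a))) f"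
    using f lborel_affine[OF c, of t] by simp
  then have "integrable lborel (\<lambda>x. (\<bar>c\<bar>^DIM('a)) *\<^sub>R f (t + c *\<^sub>R x))"
    by (simp add: integrable_density integrable_distr_eq)
  then have "integrable lborel (\<lambda>x. (1 / \<bar>c\<bar>^DIM('a)) *\<^sub>R (\<bar>c\<bar>^DIM('a)) *\<^sub>R f (t + c *\<^sub>R x))"
    by (rule integrable_scaleR_right)
  then show ?thesis
    using c by simp
qed

lemma integrable_affine_iff:
  fixes f :: "'a::euclidean_space \<Rightarrow> 'b::{banach, second_countable_topology}"
  assumes c: "c \<noteq> 0"
  shows "integrable lborel (\<lambda>x. f (t + c *\<^sub>R x)) \<longleftrightarrow> integrable lborel f"
  using integrable_affine[of f c t] c
    integrable_affine[of "\<lambda>x. f (t + c *\<^sub>R x)" "1/c" "- (1/c) *\<^sub>R t"]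
  by (auto simp: algebra_simps)

lemma integral_affine:
  fixes f :: "'a::euclidean_space \<Rightarrow> 'b::{banach, second_countable_topology}"
  assumes c: "c \<noteq> 0"
  shows "(\<bar>c\<bar>^DIM('a)) *\<^sub>R (LINT x|lborel. f (t + c *\<^sub>R x)) = (LINT x|lborel. f x)"
proof (cases "integrable lborel f")
  case True
  then have [measurable]: "f \<in> borel_measurable borel"
    by (simp add: integrable_iff_bounded)
  have "(LINT x|lborel. f x) = (LINT x|density (distr lborel borel (\<lambda>x. t + c *\<^sub>R x)) (\<lambda>_. \<bar>c\<bar>^DIM('a)). f x)"
    using lborel_affine[OF c, of t] by simp
  also have "\<dots> = (\<bar>c\<bar>^DIM('a)) *\<^sub>R (LINT x|lborel. f (t + c *\<^sub>R x))"
    by (simp add: integral_density integral_distr)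
  finally show ?thesis by simp
next
  case False
  then show ?thesis
    using integrable_affine_iff[OF c, of f t] by (simp add: not_integrable_integral_eq)
qed

lemma integrable_translate:
  fixes f :: "'a::euclidean_space \<Rightarrow> 'b::{banach, second_countable_topology}"
  shows "integrable lborel f \<Longrightarrow> integrable lborel (\<lambda>x. f (x - y))"
  using integrable_affine[of f 1 "-y"] by (simp add: algebra_simps)

lemma integral_translate:
  fixes f :: "'a::euclidean_space \<Rightarrow> 'b::{banach, second_countable_topology}"
  shows "(LINT x|lborel. f (x - y)) = (LINT x|lborel. f x)"
  using integral_affine[of 1 f "-y"] by (simp add: algebra_simps)

lemma integrable_reflect:
  fixes f :: "'a::euclidean_space \<Rightarrow> 'b::{banach, second_countable_topology}"
  shows "integrable lborel f \<Longrightarrow> integrable lborel (\<lambda>x. f (z - x))"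
  using integrable_affine[of f "-1" z] by simp

lemma integral_reflect:
  fixes f :: "'a::euclidean_space \<Rightarrow> 'b::{banach, second_countable_topology}"
  shows "(LINT x|lborel. f (z - x)) = (LINT x|lborel. f x)"
  using integral_affine[of "-1" f z] by simp

lemma integrable_bounded_mult:
  fixes f g :: "'a \<Rightarrow> complex"
  assumes "integrable M g" "f \<in> borel_measurable M" "\<And>x. norm (f x) \<le> C"
  shows "integrable M (\<lambda>x. f x * g x)"
proof (rule Bochner_Integration.integrable_bound)
  show "integrable M (\<lambda>x. C *\<^sub>R g x)"
    using assms(1) by simp
  show "(\<lambda>x. f x * g x) \<in> borel_measurable M"
    using assms by measurable
  have "0 \<le> C" using assms(3) norm_ge_zero order_trans by blast
  then show "AE x in M. norm (f x * g x) \<le> norm (C *\<^sub>R g x)"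
    by (simp add: norm_mult mult_right_mono assms(3))
qed

lemma integrable_bounded_mult2:
  fixes f g :: "'a \<Rightarrow> complex"
  assumes "integrable M g" "f \<in> borel_measurable M" "\<And>x. norm (f x) \<le> C"
  shows "integrable M (\<lambda>x. g x * f x)"
  using integrable_bounded_mult[OF assms] by (simp add: mult.commute)

lemma L1_norm_nonneg [simp]: "0 \<le> L1_norm g"
  unfolding L1_norm_def by simp

lemma L1_norm_triangle:
  assumes "integrable lborel f" "integrable lborel g"
  shows "L1_norm (\<lambda>x. f x + g x) \<le> L1_norm f + L1_norm g"
proof -
  have "L1_norm (\<lambda>x. f x + g x) \<le> (LINT x|lborel. norm (f x) + norm (g x))"
    unfolding L1_norm_def using assms
    by (intro integral_mono) (auto intro: norm_triangle_ineq)
  also have "\<dots> = L1_norm f + L1_norm g"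
    unfolding L1_norm_def using assms by simp
  finally show ?thesis .
qed

lemma L1_norm_minus: "L1_norm (\<lambda>x. f x - g x) = L1_norm (\<lambda>x. g x - f x)"
  unfolding L1_norm_def by (simp add: norm_minus_commute)

lemma L1_norm_translate: "L1_norm (\<lambda>x. g (x - y)) = L1_norm g"
  unfolding L1_norm_def by (rule integral_translate[of "\<lambda>x. norm (g x)"])

lemma L1_norm_eq_0_iff:
  assumes "integrable lborel g"
  shows "L1_norm g = 0 \<longleftrightarrow> (AE x in lborel. g x = 0)"
  unfolding L1_norm_def using assms by (subst integral_nonneg_eq_0_iff_AE) auto

lemma integrable_conv_kernel:
  fixes f g :: "'a::euclidean_space \<Rightarrow> complex"
  assumes f: "integrable lborel f" and g: "integrable lborel g"
  shows "integrable (lborel \<Otimes>\<^sub>M lborel) (\<lambda>(w, z). f w * g (z - w))"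
proof -
  have [measurable]: "f \<in> borel_measurable borel" "g \<in> borel_measurable borel"
    using f g by (simp_all add: integrable_iff_bounded)
  have eq: "(LINT z|lborel. norm (f w * g (z - w))) = norm (f w) * L1_norm g" for w
    using integral_translate[of "\<lambda>x. norm (g x)" w] by (simp add: norm_mult L1_norm_def)
  show ?thesis
  proof (rule lborel_pair.Fubini_integrable)
    show "(\<lambda>(w, z). f w * g (z - w)) \<in> borel_measurable (lborel \<Otimes>\<^sub>M lborel)"
      by measurable
    show "integrable lborel (\<lambda>w. LINT z|lborel. norm (case (w, z) of (w, z) \<Rightarrow> f w * g (z - w)))"
      using f by (simp add: eq)
    show "AE w in lborel. integrable lborel (\<lambda>z. case (w, z) of (w, z) \<Rightarrow> f w * g (z - w))"
      using g by (simp add: integrable_translate)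
  qed
qed

lemma integrable_conv:
  fixes f g :: "'a::euclidean_space \<Rightarrow> complex"
  assumes f: "integrable lborel f" and g: "integrable lborel g"
  shows "integrable lborel (conv f g)"
  using lborel_pair.integrable_snd[OF integrable_conv_kernel[OF f g]] unfolding conv_def .

text \<open>Minkowski's inequality for integrals, in \<open>L\<^sup>1\<close>.\<close>

lemma integral_norm_kernel_le:
  fixes H :: "'a::euclidean_space \<Rightarrow> 'a \<Rightarrow> complex"
  assumes H: "integrable (lborel \<Otimes>\<^sub>M lborel) (\<lambda>(w, z). H w z)"
  shows "L1_norm (\<lambda>z. LINT w|lborel. H w z) \<le> (LINT w|lborel. L1_norm (H w))"
proof -
  have H': "integrable (lborel \<Otimes>\<^sub>M lborel) (\<lambda>(w, z). norm (H w z))"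
    using integrable_norm[OF H] by (simp add: case_prod_unfold)
  have "L1_norm (\<lambda>z. LINT w|lborel. H w z) \<le> (LINT z|lborel. LINT w|lborel. norm (H w z))"
    unfolding L1_norm_def
    by (intro integral_mono lborel_pair.integrable_snd integrable_norm H H' integral_norm_bound)
  also have "\<dots> = (LINT w|lborel. LINT z|lborel. norm (H w z))"
    by (rule lborel_pair.Fubini_integral[OF H'])
  finally show ?thesis by (simp add: L1_norm_def)
qed

lemma L1_norm_conv:
  fixes f g :: "'a::euclidean_space \<Rightarrow> complex"
  assumes f: "integrable lborel f" and g: "integrable lborel g"
  shows "L1_norm (conv f g) \<le> L1_norm f * L1_norm g"
proof -
  have "L1_norm (\<lambda>z. f w * g (z - w)) = norm (f w) * L1_norm g" for w
    using integral_translate[of "\<lambda>x. norm (g x)" w] by (simp add: norm_mult L1_norm_def)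
  then show ?thesis
    using integral_norm_kernel_le[OF integrable_conv_kernel[OF f g]]
    unfolding conv_def by (simp add: L1_norm_def)
qed

lemma conv_commute: "conv f g = conv g f"
  unfolding conv_def
  using integral_reflect[of "\<lambda>w. f w * g (z - w)" z for z] by (auto simp: mult.commute)

lemma norm_conv_le:
  fixes f g :: "'a::euclidean_space \<Rightarrow> complex"
  assumes f: "f \<in> borel_measurable borel" "\<And>x. norm (f x) \<le> C" and g: "integrable lborel g"
  shows "norm (conv f g z) \<le> C * L1_norm g"
proof -
  have g': "integrable lborel (\<lambda>w. g (z - w))"
    using g by (rule integrable_reflect)
  have "norm (conv f g z) \<le> (LINT w|lborel. norm (f w * g (z - w)))"
    unfolding conv_def by (rule integral_norm_bound)
  also have "\<dots> \<le> (LINT w|lborel. C * norm (g (z - w)))"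
    using f g' by (intro integral_mono integrable_norm integrable_bounded_mult[where C=C] integrable_mult_right)
      (auto simp: norm_mult intro!: mult_right_mono)
  also have "\<dots> = C * L1_norm g"
    using integral_reflect[of "\<lambda>x. norm (g x)" z] by (simp add: L1_norm_def)
  finally show ?thesis .
qed

lemma integrable_conv_bounded:
  fixes f g :: "'a::euclidean_space \<Rightarrow> complex"
  assumes f: "f \<in> borel_measurable borel" "\<And>x. norm (f x) \<le> C" and g: "integrable lborel g"
  shows "integrable lborel (\<lambda>w. f w * g (z - w))"
  using f by (intro integrable_bounded_mult[where C=C] integrable_reflect g) auto

lemma integrable_conv_bounded2:
  fixes f g :: "'a::euclidean_space \<Rightarrow> complex"
  assumes f: "f \<in> borel_measurable borel" "\<And>x. norm (f x) \<le> C" and g: "integrable lborel g"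
  shows "integrable lborel (\<lambda>w. g w * f (z - w))"
  using f by (intro integrable_bounded_mult2[where C=C] g) auto

text \<open>The bound on the third factor makes both sides converge at every point, so that the identity holds pointwise and not
  only almost everywhere.\<close>

lemma conv_assoc:
  fixes f g h :: "'a::euclidean_space \<Rightarrow> complex"
  assumes f: "integrable lborel f" and g: "integrable lborel g"
    and h[measurable]: "h \<in> borel_measurable borel" and hC: "\<And>x. norm (h x) \<le> C"
  shows "conv (conv f g) h = conv f (conv g h)"
proof
  fix z
  have I: "integrable (lborel \<Otimes>\<^sub>M lborel) (\<lambda>(w, u). f w * g (u - w) * h (z - u))"
    using integrable_bounded_mult2[OF integrable_conv_kernel[OF f g], of "\<lambda>(w, u). h (z - u)" C] hC
    by (simp add: case_prod_unfold)
  have "conv (conv f g) h z = (LINT u|lborel. LINT w|lborel. f w * g (u - w) * h (z - u))"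
    unfolding conv_def by simp
  also have "\<dots> = (LINT w|lborel. LINT u|lborel. f w * g (u - w) * h (z - u))"
    by (rule lborel_pair.Fubini_integral[OF I])
  also have "\<dots> = (LINT w|lborel. f w * conv g h (z - w))"
  proof (rule Bochner_Integration.integral_cong[OF refl])
    fix w
    show "(LINT u|lborel. f w * g (u - w) * h (z - u)) = f w * conv g h (z - w)"
      using integral_translate[of "\<lambda>u. g u * h (z - w - u)" w]
      by (simp add: conv_def algebra_simps)
  qed
  finally show "conv (conv f g) h z = conv f (conv g h) z"
    by (simp add: conv_def)
qed

lemma borel_measurable_conv:
  assumes [measurable]: "f \<in> borel_measurable borel" "g \<in> borel_measurable borel"
  shows "conv f g \<in> borel_measurable borel"
proof -
  have "(\<lambda>z. LINT w|lborel. f w * g (z - w)) \<in> borel_measurable lborel"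
    by (rule lborel.borel_measurable_lebesgue_integral) measurable
  then show ?thesis unfolding conv_def[abs_def] by simp
qed

lemma conv_assoc_bounded:
  fixes f g h :: "'a::euclidean_space \<Rightarrow> complex"
  assumes f: "integrable lborel f" and g: "integrable lborel g"
    and h: "h \<in> borel_measurable borel" "\<And>x. norm (h x) \<le> C"
  shows "conv h (conv f g) = conv (conv h f) g"
proof -
  have "conv h (conv f g) = conv (conv g f) h" by (metis conv_commute)
  also have "\<dots> = conv g (conv f h)" by (rule conv_assoc[OF g f h])
  finally show ?thesis by (metis conv_commute)
qed

section \<open>Continuity of translation in \<open>L\<^sup>1\<close>\<close>

lemma L1_norm_translate_approx:
  assumes g: "integrable lborel g" and k: "integrable lborel k"
  shows "L1_norm (\<lambda>x. g (x - y) - g x) \<le> 2 * L1_norm (\<lambda>x. g x - k x) + L1_norm (\<lambda>x. k (x - y) - k x)"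
proof -
  note [simp] = g k integrable_translate
  have "L1_norm (\<lambda>x. g (x - y) - g x) =
      L1_norm (\<lambda>x. ((g (x - y) - k (x - y)) + (k x - g x)) + (k (x - y) - k x))"
    by (simp add: algebra_simps)
  also have "\<dots> \<le> L1_norm (\<lambda>x. (g (x - y) - k (x - y)) + (k x - g x)) + L1_norm (\<lambda>x. k (x - y) - k x)"
    by (rule L1_norm_triangle) simp_all
  also have "\<dots> \<le> L1_norm (\<lambda>x. g (x - y) - k (x - y)) + L1_norm (\<lambda>x. k x - g x) + L1_norm (\<lambda>x. k (x - y) - k x)"
    by (intro add_right_mono L1_norm_triangle) simp_all
  finally show ?thesis
    using L1_norm_translate[of "\<lambda>x. g x - k x" y] L1_norm_minus[of k g] by simp
qed

lemma L1_norm_translate_diff_closed: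
  assumes g: "integrable lborel g" and y: "y \<longlonglongrightarrow> 0"
    and approx: "\<And>e. e > 0 \<Longrightarrow> \<exists>k. integrable lborel k \<and> L1_norm (\<lambda>x. g x - k x) < e \<and>
          (\<lambda>n. L1_norm (\<lambda>x. k (x - y n) - k x)) \<longlonglongrightarrow> 0"
  shows "(\<lambda>n. L1_norm (\<lambda>x. g (x - y n) - g x)) \<longlonglongrightarrow> 0"
proof (rule LIMSEQ_I)
  fix e :: real assume "e > 0"
  then obtain k where k: "integrable lborel k" "L1_norm (\<lambda>x. g x - k x) < e/3"
      "(\<lambda>n. L1_norm (\<lambda>x. k (x - y n) - k x)) \<longlonglongrightarrow> 0"
    using approx[of "e/3"] by auto
  from \<open>e > 0\<close> obtain N where N: "\<And>n. n \<ge> N \<Longrightarrow> L1_norm (\<lambda>x. k (x - y n) - k x) < e/3"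
    using LIMSEQ_D[OF k(3), of "e/3"] by auto
  show "\<exists>N. \<forall>n\<ge>N. norm (L1_norm (\<lambda>x. g (x - y n) - g x) - 0) < e"
  proof (intro exI allI impI)
    fix n assume "n \<ge> N"
    then show "norm (L1_norm (\<lambda>x. g (x - y n) - g x) - 0) < e"
      using L1_norm_translate_approx[OF g k(1), of "y n"] k(2) N[of n] by simp
  qed
qed

text \<open>For an open set \<open>U\<close> the difference \<open>1\<^sub>U - 1\<^sub>U(\<cdot> - y)\<close> has integral zero, so its \<open>L\<^sup>1\<close> norm is twice the
  integral of its positive part. The positive part vanishes off \<open>U\<close> and tends to \<open>0\<close> at each point of \<open>U\<close>
  because \<open>U\<close> is open; it is dominated by \<open>1\<^sub>U\<close>.\<close>

lemma L1_norm_translate_diff_open: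
  fixes U :: "'a::euclidean_space set"
  assumes U: "open U" "emeasure lborel U < \<infinity>" and y: "y \<longlonglongrightarrow> 0"
  shows "(\<lambda>n. L1_norm (\<lambda>x. indicator U (x - y n) *\<^sub>R c - indicator U x *\<^sub>R c)) \<longlonglongrightarrow> 0"
proof -
  have [measurable]: "U \<in> sets borel" using U by simp
  let ?u = "indicator U :: 'a \<Rightarrow> real"
  have int: "integrable lborel ?u" using U by simp
  have int': "integrable lborel (\<lambda>x. ?u (x - z))" for z
    by (rule integrable_translate[OF int])
  let ?p = "\<lambda>n x. max 0 (?u x - ?u (x - y n))"
  have intp: "integrable lborel (?p n)" for n
    by (intro integrable_max integrable_zero Bochner_Integration.integrable_diff int int')
  have "(\<lambda>n. LINT x|lborel. ?p n x) \<longlonglongrightarrow> (LINT x::'a|lborel. (0::real))"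
  proof (rule integral_dominated_convergence[where w="?u"])
    show "AE x in lborel. (\<lambda>n. ?p n x) \<longlonglongrightarrow> 0"
    proof (rule AE_I2)
      fix x
      show "(\<lambda>n. ?p n x) \<longlonglongrightarrow> 0"
      proof (cases "x \<in> U")
        case True
        have "(\<lambda>n. x - y n) \<longlonglongrightarrow> x - 0" by (intro tendsto_intros y)
        then have "\<forall>\<^sub>F n in sequentially. x - y n \<in> U"
          using True U by (intro topological_tendstoD) auto
        then have "\<forall>\<^sub>F n in sequentially. ?p n x = 0"
          by eventually_elim (use True in auto)
        then show ?thesis by (rule tendsto_eventually)
      next
        case False
        then have "?p n x = 0" for n by (auto simp: indicator_def)
        then show ?thesis by simp
      qed
    qed
    show "AE x in lborel. norm (?p n x) \<le> ?u x" for n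
      by (rule AE_I2) (auto simp: indicator_def)
  qed (use int intp in auto)
  then have lim: "(\<lambda>n. norm c * (2 * (LINT x|lborel. ?p n x))) \<longlonglongrightarrow> norm c * (2 * 0)"
    by (intro tendsto_intros) simp
  have "L1_norm (\<lambda>x. indicator U (x - y n) *\<^sub>R c - indicator U x *\<^sub>R c)
      = norm c * (2 * (LINT x|lborel. ?p n x))" for n
  proof -
    have "norm (?u (x - y n) *\<^sub>R c - ?u x *\<^sub>R c) = norm c * (2 * ?p n x + (?u (x - y n) - ?u x))" for x
      by (auto simp: indicator_def)
    then have "L1_norm (\<lambda>x. indicator U (x - y n) *\<^sub>R c - indicator U x *\<^sub>R c)
      = (LINT x|lborel. norm c * (2 * ?p n x + (?u (x - y n) - ?u x)))"
      unfolding L1_norm_def by presburger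
    also have "\<dots> = norm c * (2 * (LINT x|lborel. ?p n x) + ((LINT x|lborel. ?u (x - y n)) - (LINT x|lborel. ?u x)))"
      using intp int int' by (subst integral_mult_right_zero) (simp del: integral_indicator)
    also have "(LINT x|lborel. ?u (x - y n)) = (LINT x|lborel. ?u x)"
      by (rule integral_translate)
    finally show ?thesis by simp
  qed
  with lim show ?thesis by simp
qed

text \<open>Sets of finite measure are approximated from outside by open sets, and the property passes to sums and to limits in
  \<open>L\<^sup>1\<close>.\<close>

lemma L1_norm_translate_diff_tendsto:
  fixes g :: "'a::euclidean_space \<Rightarrow> complex"
  assumes g: "integrable lborel g" and y: "y \<longlonglongrightarrow> 0"
  shows "(\<lambda>n. L1_norm (\<lambda>x. g (x - y n) - g x)) \<longlonglongrightarrow> 0"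
  using g
proof (induction g rule: integrable_induct)
  case (base A c)
  have [measurable]: "A \<in> sets borel" using base by simp
  show ?case
  proof (rule L1_norm_translate_diff_closed[OF _ y])
    show "integrable lborel (\<lambda>x. indicat_real A x *\<^sub>R c)"
      using base by (intro integrable_scaleR_left integrable_real_indicator) auto
    fix e :: real assume "e > 0"
    define d where "d = e / (norm c + 1)"
    have "norm c + 1 > 0" by (simp add: add_nonneg_pos)
    then have d: "d > 0" "norm c * d < e"
      using \<open>e > 0\<close> by (auto simp: d_def field_simps)
    obtain U where U: "open U" "A \<subseteq> U" "emeasure lborel (U - A) < d"
      using outer_regular_lborel[of A d] d by auto
    have [measurable]: "U \<in> sets borel" using U by simp
    have fin: "emeasure lborel (U - A) < \<infinity>"
      using order.strict_trans[OF U(3) ennreal_less_top] by simp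
    have "emeasure lborel U \<le> emeasure lborel A + emeasure lborel (U - A)"
      using emeasure_subadditive[of A lborel "U - A"] U(2) by (simp add: Un_absorb1)
    also have "\<dots> < \<infinity>" using base fin by simp
    finally have finU: "emeasure lborel U < \<infinity>" .
    have "L1_norm (\<lambda>x. indicat_real A x *\<^sub>R c - indicat_real U x *\<^sub>R c)
      = (LINT x|lborel. norm c * indicat_real (U - A) x)"
      unfolding L1_norm_def using U(2)
      by (intro Bochner_Integration.integral_cong) (auto simp: indicator_def)
    also have "\<dots> = norm c * measure lborel (U - A)"
      by simp
    also have "\<dots> \<le> norm c * d"
      using U(3) d(1) by (intro mult_left_mono) (auto simp: measure_def intro!: enn2real_leI)
    finally have "L1_norm (\<lambda>x. indicat_real A x *\<^sub>R c - indicat_real U x *\<^sub>R c) < e"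
      using d by linarith
    moreover have "integrable lborel (\<lambda>x. indicat_real U x *\<^sub>R c)"
      using finU by (intro integrable_scaleR_left integrable_real_indicator) auto
    ultimately show "\<exists>k. integrable lborel k \<and> L1_norm (\<lambda>x. indicat_real A x *\<^sub>R c - k x) < e \<and>
          (\<lambda>n. L1_norm (\<lambda>x. k (x - y n) - k x)) \<longlonglongrightarrow> 0"
      using L1_norm_translate_diff_open[OF U(1) finU y, of c] by blast
  qed
next
  case (add f g)
  have "L1_norm (\<lambda>x. f (x - y n) + g (x - y n) - (f x + g x))
     \<le> L1_norm (\<lambda>x. f (x - y n) - f x) + L1_norm (\<lambda>x. g (x - y n) - g x)" for n
    using L1_norm_triangle[of "\<lambda>x. f (x - y n) - f x" "\<lambda>x. g (x - y n) - g x"] add.hyps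
    by (simp add: integrable_translate algebra_simps)
  then show ?case
    by (intro tendsto_sandwich[OF _ _ tendsto_const tendsto_add_zero[OF add.IH]] always_eventually allI) auto
next
  case (lim f s)
  have [measurable]: "f \<in> borel_measurable lborel" "\<And>i. s i \<in> borel_measurable lborel"
    using lim by auto
  have "(\<lambda>i. LINT x|lborel. norm (f x - s i x)) \<longlonglongrightarrow> (LINT x::'a|lborel. (0::real))"
  proof (rule integral_dominated_convergence[where w="\<lambda>x. 3 * norm (f x)"])
    show "AE x in lborel. (\<lambda>i. norm (f x - s i x)) \<longlonglongrightarrow> 0"
      using lim.hyps(2) by (intro AE_I2) (auto intro!: tendsto_eq_intros)
    show "AE x in lborel. norm (norm (f x - s i x)) \<le> 3 * norm (f x)" for i
    proof (rule AE_I2)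
      fix x
      show "norm (norm (f x - s i x)) \<le> 3 * norm (f x)"
        using lim.hyps(3)[of x i] norm_triangle_ineq4[of "f x" "s i x"] by simp
    qed
  qed (use lim.hyps in auto)
  then have conv: "(\<lambda>i. L1_norm (\<lambda>x. f x - s i x)) \<longlonglongrightarrow> 0"
    by (simp add: L1_norm_def)
  show ?case
  proof (rule L1_norm_translate_diff_closed[OF \<open>integrable lborel f\<close> y])
    fix e :: real assume "e > 0"
    then obtain i where "L1_norm (\<lambda>x. f x - s i x) < e"
      using LIMSEQ_D[OF conv, of e] by auto
    then show "\<exists>k. integrable lborel k \<and> L1_norm (\<lambda>x. f x - k x) < e \<and>
          (\<lambda>n. L1_norm (\<lambda>x. k (x - y n) - k x)) \<longlonglongrightarrow> 0"
      using lim by blast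
  qed
qed

text \<open>The common core of two estimates: of the approximate identity \<open>conv (fejer_identity n) g \<rightarrow> g\<close>, and of the localisation
  \<open>conv a v \<approx> v\<close> for kernels \<open>v\<close> with frequencies close to a given one.\<close>

lemma integral_translate_diff_tendsto:
  fixes a g :: "'a::euclidean_space \<Rightarrow> complex"
  assumes a: "integrable lborel a" and g: "integrable lborel g" and r: "r \<longlonglongrightarrow> (0::real)"
  shows "(\<lambda>n. LINT y|lborel. norm (a y) * L1_norm (\<lambda>x. g (x - r n *\<^sub>R y) - g x)) \<longlonglongrightarrow> 0"
proof -
  have [measurable]: "a \<in> borel_measurable borel" "g \<in> borel_measurable borel"
    using a g by (simp_all add: integrable_iff_bounded)
  have bound: "L1_norm (\<lambda>x. g (x - z) - g x) \<le> 2 * L1_norm g" for z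
    using L1_norm_translate_approx[OF g, of "\<lambda>_. 0" z] by (simp add: L1_norm_def)
  have "(\<lambda>n. LINT y|lborel. norm (a y) * L1_norm (\<lambda>x. g (x - r n *\<^sub>R y) - g x))
     \<longlonglongrightarrow> (LINT y::'a|lborel. (0::real))"
  proof (rule integral_dominated_convergence[where w="\<lambda>y. norm (a y) * (2 * L1_norm g)"])
    show "(\<lambda>y. norm (a y) * L1_norm (\<lambda>x. g (x - r n *\<^sub>R y) - g x)) \<in> borel_measurable lborel" for n
      unfolding L1_norm_def
      by (intro borel_measurable_times lborel.borel_measurable_lebesgue_integral) measurable
    show "integrable lborel (\<lambda>y. norm (a y) * (2 * L1_norm g))"
      using a by simp
    show "AE y in lborel. (\<lambda>n. norm (a y) * L1_norm (\<lambda>x. g (x - r n *\<^sub>R y) - g x)) \<longlonglongrightarrow> 0"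
    proof (rule AE_I2)
      fix y :: 'a
      have "(\<lambda>n. r n *\<^sub>R y) \<longlonglongrightarrow> 0" using tendsto_scaleR[OF r tendsto_const, of y] by simp
      from tendsto_mult[OF tendsto_const[of "norm (a y)"] L1_norm_translate_diff_tendsto[OF g this]]
      show "(\<lambda>n. norm (a y) * L1_norm (\<lambda>x. g (x - r n *\<^sub>R y) - g x)) \<longlonglongrightarrow> 0" by simp
    qed
    show "AE y in lborel. norm (norm (a y) * L1_norm (\<lambda>x. g (x - r n *\<^sub>R y) - g x)) \<le> norm (a y) * (2 * L1_norm g)" for n
      by (rule AE_I2) (simp add: abs_mult mult_left_mono bound)
  qed auto
  then show ?thesis by simp
qed

section \<open>Band-limited functions\<close>

inductive_set trig_poly :: "'a::euclidean_space set \<Rightarrow> ('a \<Rightarrow> complex) set" for S where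
  zero: "(\<lambda>_. 0) \<in> trig_poly S"
| add_char: "p \<in> trig_poly S \<Longrightarrow> \<xi> \<in> S \<Longrightarrow> (\<lambda>x. p x + c * cis (\<xi> \<bullet> x)) \<in> trig_poly S"

lemma trig_poly_continuous: "p \<in> trig_poly S \<Longrightarrow> continuous_on UNIV p"
  by (induction rule: trig_poly.induct) (auto intro!: continuous_intros simp: cis_conv_exp)

lemma trig_poly_measurable: "p \<in> trig_poly S \<Longrightarrow> p \<in> borel_measurable borel"
  using trig_poly_continuous borel_measurable_continuous_onI by blast

lemma trig_poly_add:
  assumes "q \<in> trig_poly S" "p \<in> trig_poly S"
  shows "(\<lambda>x. p x + q x) \<in> trig_poly S"
  using assms
proof (induction q rule: trig_poly.induct)
  case (add_char q \<xi> c)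
  then show ?case
    using trig_poly.add_char[of "\<lambda>x. p x + q x" S \<xi> c] by (simp add: add.assoc)
qed simp

lemma trig_poly_char: "\<xi> \<in> S \<Longrightarrow> (\<lambda>x. c * cis (\<xi> \<bullet> x)) \<in> trig_poly S"
  using trig_poly.add_char[OF trig_poly.zero, of \<xi> S c] by simp

lemma trig_poly_sum:
  assumes "finite I" "\<And>i. i \<in> I \<Longrightarrow> p i \<in> trig_poly S"
  shows "(\<lambda>x. \<Sum>i\<in>I. p i x) \<in> trig_poly S"
  using assms by (induction I rule: finite_induct) (auto intro!: trig_poly.zero trig_poly_add)

lemma trig_poly_mult_char:
  assumes "p \<in> trig_poly S" "\<And>s. s \<in> S \<Longrightarrow> \<xi> + s \<in> T"
  shows "(\<lambda>x. c * cis (\<xi> \<bullet> x) * p x) \<in> trig_poly T"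
  using assms
proof (induction p rule: trig_poly.induct)
  case zero
  then show ?case by (simp add: trig_poly.zero)
next
  case (add_char p s d)
  have "(\<lambda>x. c * cis (\<xi> \<bullet> x) * (p x + d * cis (s \<bullet> x)))
      = (\<lambda>x. c * cis (\<xi> \<bullet> x) * p x + (c * d) * cis ((\<xi> + s) \<bullet> x))"
    by (auto simp: algebra_simps inner_add_left simp flip: cis_mult)
  then show ?case
    using trig_poly.add_char[of "\<lambda>x. c * cis (\<xi> \<bullet> x) * p x" T "\<xi> + s" "c * d"] add_char by auto
qed

lemma trig_poly_mult:
  assumes "p \<in> trig_poly S" "q \<in> trig_poly T" "\<And>s t. s \<in> S \<Longrightarrow> t \<in> T \<Longrightarrow> s + t \<in> U"
  shows "(\<lambda>x. p x * q x) \<in> trig_poly U"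
  using assms
proof (induction p rule: trig_poly.induct)
  case zero
  then show ?case by (simp add: trig_poly.zero)
next
  case (add_char p s d)
  have "(\<lambda>x. (p x + d * cis (s \<bullet> x)) * q x) = (\<lambda>x. p x * q x + d * cis (s \<bullet> x) * q x)"
    by (auto simp: algebra_simps)
  then show ?case
    using trig_poly_add[of "\<lambda>x. d * cis (s \<bullet> x) * q x" U "\<lambda>x. p x * q x"]
      trig_poly_mult_char[OF \<open>q \<in> trig_poly T\<close>, of s U d] add_char by auto
qed

lemma trig_poly_prod_cball:
  fixes p :: "'b \<Rightarrow> 'a::euclidean_space \<Rightarrow> complex"
  assumes "finite B" "\<And>b. b \<in> B \<Longrightarrow> p b \<in> trig_poly (cball 0 r)"
  shows "(\<lambda>x. \<Prod>b\<in>B. p b x) \<in> trig_poly (cball 0 (card B * r))"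
  using assms
proof (induction B rule: finite_induct)
  case empty
  have "(\<lambda>_. 1) \<in> trig_poly (cball 0 0 :: 'a set)"
    using trig_poly_char[of 0 "cball 0 0 :: 'a set" 1] by simp
  then show ?case by simp
next
  case (insert b B)
  show ?case
    using insert by (simp, intro trig_poly_mult[where S="cball 0 r" and T="cball 0 (card B * r)"])
      (auto simp: algebra_simps intro: norm_triangle_mono)
qed

lemma trig_poly_scale:
  assumes "p \<in> trig_poly S" "\<And>s. s \<in> S \<Longrightarrow> r *\<^sub>R s \<in> T"
  shows "(\<lambda>x. p (r *\<^sub>R x)) \<in> trig_poly T"
  using assms
proof (induction p rule: trig_poly.induct)
  case zero
  then show ?case by (simp add: trig_poly.zero)
next
  case (add_char p s d)
  then show ?case
    using trig_poly.add_char[of "\<lambda>x. p (r *\<^sub>R x)" T "r *\<^sub>R s" d] by auto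
qed

text \<open>A stand-in for having a Fourier transform supported in \<open>S\<close>. Bounded pointwise limits of trigonometric polynomials
  are stable under products and pass through integrals by dominated convergence.\<close>

definition bandlimited :: "'a::euclidean_space set \<Rightarrow> ('a \<Rightarrow> complex) \<Rightarrow> bool" where
  "bandlimited S g \<longleftrightarrow> (\<exists>p C. (\<forall>n::nat. p n \<in> trig_poly S) \<and> (\<forall>n x. norm (p n x) \<le> C)
     \<and> (\<forall>x. (\<lambda>n. p n x) \<longlonglongrightarrow> g x))"

lemma bandlimitedE:
  assumes "bandlimited S g"
  obtains p C where "\<And>n::nat. p n \<in> trig_poly S" "\<And>n x. norm (p n x) \<le> C"
    "\<And>x. (\<lambda>n. p n x) \<longlonglongrightarrow> g x"
  using assms unfolding bandlimited_def by blast

lemma bandlimited_measurable: 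
  assumes "bandlimited S g" shows "g \<in> borel_measurable borel"
  using assms
  by (elim bandlimitedE) (rule borel_measurable_LIMSEQ_metric[OF trig_poly_measurable])

lemma bandlimited_bounded:
  assumes "bandlimited S g" obtains C where "\<And>x. norm (g x) \<le> C"
  using assms
  by (elim bandlimitedE) (metis LIMSEQ_le_const2 tendsto_norm)

lemma bandlimited_mult_char:
  assumes "bandlimited S g" "\<And>s. s \<in> S \<Longrightarrow> \<xi> + s \<in> T"
  shows "bandlimited T (\<lambda>x. c * cis (\<xi> \<bullet> x) * g x)"
proof -
  obtain p C where p: "\<And>n::nat. p n \<in> trig_poly S" "\<And>n x. norm (p n x) \<le> C"
    "\<And>x. (\<lambda>n. p n x) \<longlonglongrightarrow> g x" using assms(1) by (rule bandlimitedE) blast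
  show ?thesis unfolding bandlimited_def
  proof (intro exI conjI allI)
    show "(\<lambda>x. c * cis (\<xi> \<bullet> x) * p n x) \<in> trig_poly T" for n
      by (rule trig_poly_mult_char[OF p(1) assms(2)])
    show "norm (c * cis (\<xi> \<bullet> x) * p n x) \<le> norm c * C" for n x
      using p(2) by (simp add: norm_mult mult_left_mono)
    show "(\<lambda>n. c * cis (\<xi> \<bullet> x) * p n x) \<longlonglongrightarrow> c * cis (\<xi> \<bullet> x) * g x" for x
      by (intro tendsto_mult_left p(3))
  qed
qed

lemma bandlimited_scale:
  assumes "bandlimited S g" "\<And>s. s \<in> S \<Longrightarrow> r *\<^sub>R s \<in> T"
  shows "bandlimited T (\<lambda>x. g (r *\<^sub>R x))"
  using assms(1) unfolding bandlimited_def
  by (elim exE conjE, rule_tac x="\<lambda>n x. p n (r *\<^sub>R x)" in exI)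
    (auto intro: trig_poly_scale assms(2))

lemma bandlimited_mono: "bandlimited S g \<Longrightarrow> S \<subseteq> T \<Longrightarrow> bandlimited T g"
  using bandlimited_scale[of S g 1 T] by auto

lemma conv_trig_poly:
  assumes v: "integrable lborel v" and c: "\<And>\<xi>. \<xi> \<in> S \<Longrightarrow> fourier v \<xi> = c" and p: "p \<in> trig_poly S"
  shows "integrable lborel (\<lambda>w. v w * p (z - w)) \<and> conv v p z = c * p z"
  using p
proof (induction p rule: trig_poly.induct)
  case zero
  then show ?case by (simp add: conv_def)
next
  case (add_char p \<xi> d)
  have eq: "v w * (p (z - w) + d * cis (\<xi> \<bullet> (z - w)))
     = v w * p (z - w) + d * cis (\<xi> \<bullet> z) * (v w * cis (- (\<xi> \<bullet> w)))" for w
    by (simp add: algebra_simps inner_diff_right cis_mult)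
  have [measurable]: "v \<in> borel_measurable borel" using v by (simp add: integrable_iff_bounded)
  have i: "integrable lborel (\<lambda>w. v w * cis (- (\<xi> \<bullet> w)))"
  proof (rule integrable_bounded_mult2[OF v, where C=1])
    have "continuous_on UNIV (\<lambda>w. cis (- (\<xi> \<bullet> w)))"
      unfolding cis_conv_exp by (intro continuous_intros)
    then show "(\<lambda>w. cis (- (\<xi> \<bullet> w))) \<in> borel_measurable lborel"
      using borel_measurable_continuous_onI by auto
  qed simp
  have "conv v (\<lambda>x. p x + d * cis (\<xi> \<bullet> x)) z = conv v p z + d * cis (\<xi> \<bullet> z) * fourier v \<xi>"
    unfolding conv_def eq fourier_def using add_char i by simp
  moreover have "integrable lborel (\<lambda>w. v w * p (z - w) + d * cis (\<xi> \<bullet> z) * (v w * cis (- (\<xi> \<bullet> w))))"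
    using add_char i by (intro Bochner_Integration.integrable_add integrable_mult_right) auto
  ultimately show ?case
    unfolding eq using add_char c[of \<xi>] by (simp add: algebra_simps)
qed

text \<open>A band-limited function is an eigenfunction of every convolution operator whose Fourier transform is constant on the
  band. For trigonometric polynomials this is the definition of the Fourier transform, and dominated convergence
  carries it to their bounded limits. The values \<open>c = 1\<close> (reproducing kernels) and \<open>c = 0\<close> (uniqueness of the
  Fourier transform) are used.\<close>

lemma conv_bandlimited:
  assumes v: "integrable lborel v" and c: "\<And>\<xi>. \<xi> \<in> S \<Longrightarrow> fourier v \<xi> = c" and g: "bandlimited S g"
  shows "conv v g z = c * g z"
proof -
  obtain p C where p: "\<And>n::nat. p n \<in> trig_poly S" "\<And>n x. norm (p n x) \<le> C"
    "\<And>x. (\<lambda>n. p n x) \<longlonglongrightarrow> g x" using g by (rule bandlimitedE) blast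
  have [measurable]: "v \<in> borel_measurable borel" "g \<in> borel_measurable borel" "\<And>n. p n \<in> borel_measurable borel"
    using v g trig_poly_measurable[OF p(1)] by (auto simp: integrable_iff_bounded bandlimited_measurable)
  have "(\<lambda>n. LINT w|lborel. v w * p n (z - w)) \<longlonglongrightarrow> (LINT w|lborel. v w * g (z - w))"
  proof (rule integral_dominated_convergence[where w="\<lambda>w. norm (v w) * C"])
    show "AE w in lborel. (\<lambda>n. v w * p n (z - w)) \<longlonglongrightarrow> v w * g (z - w)"
      by (auto intro!: tendsto_intros p(3))
    show "AE w in lborel. norm (v w * p n (z - w)) \<le> norm (v w) * C" for n
      by (auto simp: norm_mult intro!: mult_left_mono p(2))
  qed (use v in auto)
  moreover have "(LINT w|lborel. v w * p n (z - w)) = c * p n z" for n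
    using conv_trig_poly[OF v c p(1)[of n], of z] by (simp add: conv_def)
  ultimately have "(\<lambda>n. c * p n z) \<longlonglongrightarrow> conv v g z" by (simp add: conv_def)
  moreover have "(\<lambda>n. c * p n z) \<longlonglongrightarrow> c * g z" by (intro tendsto_intros p(3))
  ultimately show ?thesis by (rule LIMSEQ_unique)
qed

section \<open>Fejer kernels\<close>

text \<open>The square of \<open>sin (t/2) / (t/2)\<close>.\<close>

definition fejer :: "real \<Rightarrow> real" where
  "fejer t = (if t = 0 then 1 else 2 * (1 - cos t) / t\<^sup>2)"

lemma fejer_mult_square: "t\<^sup>2 * fejer t = 2 * (1 - cos t)"
  by (simp add: fejer_def)

lemma fejer_nonneg: "0 \<le> fejer t"
  by (simp add: fejer_def)

lemma fejer_le_1: "fejer t \<le> 1"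
proof -
  have "2 * (1 - cos t) = (2 * sin (t/2))\<^sup>2"
    using cos_double_sin[of "t/2"] by (simp add: power2_eq_square)
  also have "\<dots> \<le> t\<^sup>2"
    using abs_sin_x_le_abs_x[of "t/2"] by (intro abs_le_square_iff[THEN iffD1]) (simp add: abs_mult)
  finally show ?thesis by (simp add: fejer_def)
qed

lemma fejer_decay: "fejer t \<le> 5 / (1 + t\<^sup>2)"
proof -
  have "2 * (1 - cos t) \<le> 4"
    by (smt (verit) cos_ge_minus_one)
  then have "(1 + t\<^sup>2) * fejer t \<le> 5"
    using fejer_le_1[of t] unfolding distrib_right fejer_mult_square by simp
  then show ?thesis by (simp add: field_simps add_pos_nonneg)
qed

lemma fejer_tendsto_1: "fejer \<midarrow>0\<rightarrow> 1"
proof -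
  have "((\<lambda>t::real. 2 * (1 - cos t) / t\<^sup>2) \<longlongrightarrow> 1) (at 0)"
    by real_asymp
  moreover have "\<forall>\<^sub>F t in at 0. 2 * (1 - cos t) / t\<^sup>2 = fejer t"
    by (auto simp: fejer_def eventually_at_filter)
  ultimately show ?thesis using tendsto_cong by fastforce
qed

lemma continuous_fejer: "continuous_on UNIV fejer"
proof (rule continuous_at_imp_continuous_on, rule ballI)
  fix t :: real
  show "isCont fejer t"
  proof (cases "t = 0")
    case True
    then show ?thesis using fejer_tendsto_1 by (simp add: isCont_def fejer_def)
  next
    case False
    have "\<forall>\<^sub>F s in nhds t. s \<noteq> 0" using False by (intro t1_space_nhds) 
    then have "\<forall>\<^sub>F s in nhds t. fejer s = 2 * (1 - cos s) / s\<^sup>2"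
      by eventually_elim (simp add: fejer_def)
    moreover have "isCont (\<lambda>s. 2 * (1 - cos s) / s\<^sup>2) t"
      using False by (intro continuous_intros) auto
    ultimately show ?thesis by (simp add: isCont_cong)
  qed
qed

lemma measurable_fejer [measurable]: "fejer \<in> borel_measurable borel"
  using continuous_fejer by (rule borel_measurable_continuous_onI)

lemma integrable_inverse_one_plus_square: "integrable lborel (\<lambda>x::real. inverse (1 + x\<^sup>2))"
  using integrable_inverse_1_plus_square by (simp add: set_integrable_def)

lemma integrable_fejer: "integrable lborel fejer"
proof (rule Bochner_Integration.integrable_bound)
  show "integrable lborel (\<lambda>x::real. 5 * inverse (1 + x\<^sup>2))"
    using integrable_inverse_one_plus_square by simp
  show "AE x in lborel. norm (fejer x) \<le> norm (5 * inverse (1 + x\<^sup>2))"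
    using fejer_decay fejer_nonneg by (auto simp: divide_inverse)
qed simp

lemma continuous_AE_zero:
  fixes f :: "'a::euclidean_space \<Rightarrow> 'b::real_normed_vector"
  assumes f: "continuous_on UNIV f" and ae: "AE x in lborel. f x = 0"
  shows "f x = 0"
proof (rule ccontr)
  assume "f x \<noteq> 0"
  have U: "open {x. f x \<noteq> 0}"
    using f by (intro open_Collect_neq continuous_intros)
  then have "{x. f x \<noteq> 0} \<in> null_sets lborel"
    using ae by (subst AE_iff_null_sets) auto
  then have "negligible {x. f x \<noteq> 0}"
    by (simp add: negligible_iff_null_sets null_sets_completionI)
  then show False
    using U \<open>f x \<noteq> 0\<close> open_not_negligible by blast
qed

definition fejer_mass :: real where "fejer_mass = (LINT t|lborel. fejer t)"

lemma fejer_mass_pos: "0 < fejer_mass"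
proof -
  have "0 \<le> fejer_mass" unfolding fejer_mass_def using fejer_nonneg by simp
  moreover have "fejer_mass \<noteq> 0"
  proof
    assume "fejer_mass = 0"
    then have "AE t in lborel. fejer t = 0"
      unfolding fejer_mass_def using integrable_fejer fejer_nonneg
      by (subst (asm) integral_nonneg_eq_0_iff_AE) auto
    then have "fejer 0 = 0" by (rule continuous_AE_zero[OF continuous_fejer])
    then show False by (simp add: fejer_def)
  qed
  ultimately show ?thesis by simp
qed

lemma integral_fejer_scale:
  "integrable lborel (\<lambda>x. t\<^sup>2 * fejer (t * x))"
  "(LINT x|lborel. t\<^sup>2 * fejer (t * x)) = \<bar>t\<bar> * fejer_mass"
proof -
  show "integrable lborel (\<lambda>x. t\<^sup>2 * fejer (t * x))"
    using integrable_affine[OF integrable_fejer, of t 0] by (cases "t = 0") auto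
  show "(LINT x|lborel. t\<^sup>2 * fejer (t * x)) = \<bar>t\<bar> * fejer_mass"
  proof (cases "t = 0")
    case False
    have "(LINT x|lborel. t\<^sup>2 * fejer (t * x)) = \<bar>t\<bar> * (\<bar>t\<bar> * (LINT x|lborel. fejer (t * x)))"
      by (simp add: power2_eq_square)
    also have "\<bar>t\<bar> * (LINT x|lborel. fejer (t * x)) = fejer_mass"
      using integral_affine[OF False, of fejer 0] by (simp add: fejer_mass_def)
    finally show ?thesis .
  qed simp
qed

text \<open>Up to normalisation \<open>(cos x - cos (2 x)) / x\<^sup>2\<close>, a de la Vallee Poussin kernel.\<close>

definition vallee_poussin :: "real \<Rightarrow> real" where
  "vallee_poussin x = (4 * fejer (2 * x) - fejer x) / fejer_mass"

lemma integrable_vallee_poussin: "integrable lborel vallee_poussin"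
  unfolding vallee_poussin_def[abs_def]
  using integral_fejer_scale(1)[of 2] integrable_fejer by simp

text \<open>The product-to-sum formula, arranged so that each term is a dilated Fejer kernel and can be integrated by
  \<open>integral_fejer_scale\<close>.\<close>

lemma vallee_poussin_cos:
  "vallee_poussin x * cos (\<xi> * x) =
     ((2 - \<xi>)\<^sup>2 * fejer ((2 - \<xi>) * x) + (2 + \<xi>)\<^sup>2 * fejer ((2 + \<xi>) * x)
      - (1 - \<xi>)\<^sup>2 * fejer ((1 - \<xi>) * x) - (1 + \<xi>)\<^sup>2 * fejer ((1 + \<xi>) * x)) / (2 * fejer_mass)"
proof (cases "x = 0")
  case True
  then show ?thesis using fejer_mass_pos
    by (simp add: vallee_poussin_def fejer_def field_simps power2_eq_square)
next
  case False
  have F: "t\<^sup>2 * fejer (t * x) = 2 * (1 - cos (t * x)) / x\<^sup>2" for t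
    using False by (simp add: fejer_def power_mult_distrib)
  have "vallee_poussin x = (2\<^sup>2 * fejer (2 * x) - 1\<^sup>2 * fejer (1 * x)) / fejer_mass"
    by (simp add: vallee_poussin_def)
  also have "\<dots> = 2 * (cos x - cos (2 * x)) / x\<^sup>2 / fejer_mass"
    unfolding F using False fejer_mass_pos by (simp add: field_simps)
  finally have V: "vallee_poussin x = 2 * (cos x - cos (2 * x)) / x\<^sup>2 / fejer_mass" .
  have C: "cos ((a - \<xi>) * x) + cos ((a + \<xi>) * x) = 2 * (cos (a * x) * cos (\<xi> * x))" for a
    by (simp add: algebra_simps cos_add cos_diff)
  have "(2 * (1 - cos ((2 - \<xi>) * x)) / x\<^sup>2 + 2 * (1 - cos ((2 + \<xi>) * x)) / x\<^sup>2
      - 2 * (1 - cos ((1 - \<xi>) * x)) / x\<^sup>2 - 2 * (1 - cos ((1 + \<xi>) * x)) / x\<^sup>2)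
    = 2 * ((cos ((1 - \<xi>) * x) + cos ((1 + \<xi>) * x)) - (cos ((2 - \<xi>) * x) + cos ((2 + \<xi>) * x))) / x\<^sup>2"
    using False by (simp add: field_simps)
  also have "\<dots> = 4 * (cos x - cos (2 * x)) / x\<^sup>2 * cos (\<xi> * x)"
    unfolding C by (simp add: field_simps)
  finally have E: "2 * (1 - cos ((2 - \<xi>) * x)) / x\<^sup>2 + 2 * (1 - cos ((2 + \<xi>) * x)) / x\<^sup>2
      - 2 * (1 - cos ((1 - \<xi>) * x)) / x\<^sup>2 - 2 * (1 - cos ((1 + \<xi>) * x)) / x\<^sup>2
    = 4 * (cos x - cos (2 * x)) / x\<^sup>2 * cos (\<xi> * x)" .
  show ?thesis unfolding F V E using False fejer_mass_pos by (simp add: field_simps)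
qed

text \<open>The Fourier transform of the kernel is a trapezoid with kinks at \<open>\<plusminus>1\<close> and \<open>\<plusminus>2\<close>. By
  \<open>integral_fejer_scale\<close> it is a combination of \<open>\<bar>2 \<plusminus> \<xi>\<bar>\<close> and \<open>\<bar>1 \<plusminus> \<xi>\<bar>\<close>, in which the moduli can be
  dropped when \<open>\<bar>\<xi>\<bar> \<le> 1\<close>.\<close>

lemma fourier_vallee_poussin:
  assumes "\<bar>\<xi>\<bar> \<le> 1"
  shows "(LINT x|lborel. of_real (vallee_poussin x) * cis (- (\<xi> * x))) = 1"
proof -
  have [measurable]: "vallee_poussin \<in> borel_measurable borel"
    unfolding vallee_poussin_def[abs_def] by measurable
  have int: "integrable lborel (\<lambda>x. of_real (vallee_poussin x) * cis (- (\<xi> * x)))"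
  proof (rule integrable_bounded_mult2[where C=1])
    have "continuous_on UNIV (\<lambda>w. cis (- (\<xi> * w)))"
      unfolding cis_conv_exp by (intro continuous_intros)
    then show "(\<lambda>w. cis (- (\<xi> * w))) \<in> borel_measurable lborel"
      using borel_measurable_continuous_onI by auto
  qed (use integrable_vallee_poussin in auto)
  have even: "vallee_poussin (- x) = vallee_poussin x" for x
    by (simp add: vallee_poussin_def fejer_def)
  have re: "(LINT x|lborel. vallee_poussin x * cos (\<xi> * x)) = 1"
  proof -
    have "(LINT x|lborel. vallee_poussin x * cos (\<xi> * x))
      = (\<bar>2 - \<xi>\<bar> * fejer_mass + \<bar>2 + \<xi>\<bar> * fejer_mass - \<bar>1 - \<xi>\<bar> * fejer_mass - \<bar>1 + \<xi>\<bar> * fejer_mass) / (2 * fejer_mass)"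
      unfolding vallee_poussin_cos integral_divide_zero
      using integral_fejer_scale by (simp only: Bochner_Integration.integral_diff
          Bochner_Integration.integral_add Bochner_Integration.integrable_diff Bochner_Integration.integrable_add)
    also have "\<dots> = 1"
      using assms fejer_mass_pos by (simp add: abs_if field_simps split: if_splits)
    finally show ?thesis .
  qed
  have im: "(LINT x|lborel. vallee_poussin x * sin (\<xi> * x)) = 0"
    using integral_reflect[of "\<lambda>x. vallee_poussin x * sin (\<xi> * x)" 0] by (simp add: even)
  show ?thesis
    using re im integral_Re[OF int] integral_Im[OF int] by (simp add: complex_eq_iff)
qed

lemma
  fixes u :: "'a::euclidean_space \<Rightarrow> real \<Rightarrow> complex"
  assumes u: "\<And>b. b \<in> Basis \<Longrightarrow> integrable lborel (u b)"
  shows integrable_prod_Basis: "integrable lborel (\<lambda>x::'a. \<Prod>b\<in>Basis. u b (x \<bullet> b))"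
    and integral_prod_Basis: "(LINT x::'a|lborel. (\<Prod>b\<in>Basis. u b (x \<bullet> b))) = (\<Prod>b\<in>Basis. (LINT t|lborel. u b t))"
proof -
  interpret product_sigma_finite "\<lambda>_::'a. lborel :: real measure" by standard
  define T :: "('a \<Rightarrow> real) \<Rightarrow> 'a" where "T = (\<lambda>f. \<Sum>b\<in>Basis. f b *\<^sub>R b)"
  have T: "T f \<bullet> b = f b" if "b \<in> Basis" for f b
    using that by (simp add: T_def)
  have [measurable]: "T \<in> (\<Pi>\<^sub>M b\<in>Basis. lborel) \<rightarrow>\<^sub>M borel"
    unfolding T_def by measurable
  have L: "(lborel :: 'a measure) = distr (\<Pi>\<^sub>M b\<in>Basis. lborel) borel T"
    unfolding T_def by (rule lborel_eq)
  have [measurable]: "u b \<in> borel_measurable borel" if "b \<in> Basis" for b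
    using u[OF that] by (simp add: integrable_iff_bounded)
  have m: "(\<lambda>x::'a. \<Prod>b\<in>Basis. u b (x \<bullet> b)) \<in> borel_measurable borel"
    by measurable
  have eq: "(\<Prod>b\<in>Basis. u b (T f \<bullet> b)) = (\<Prod>b\<in>Basis. u b (f b))" for f
    by (simp add: T)
  show "integrable lborel (\<lambda>x::'a. \<Prod>b\<in>Basis. u b (x \<bullet> b))"
    unfolding L using product_integrable_prod[of Basis u] u m
    by (simp add: integrable_distr_eq eq)
  show "(LINT x::'a|lborel. (\<Prod>b\<in>Basis. u b (x \<bullet> b))) = (\<Prod>b\<in>Basis. (LINT t|lborel. u b t))"
    unfolding L using product_integral_prod[of Basis u] u m
    by (simp add: integral_distr eq)
qed

lemma cis_inner_Basis:
  fixes \<xi> x :: "'a::euclidean_space"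
  shows "cis (- (\<xi> \<bullet> x)) = (\<Prod>b\<in>Basis. cis (- ((\<xi> \<bullet> b) * (x \<bullet> b))))"
proof -
  have "cis (\<Sum>b\<in>B. g b) = (\<Prod>b\<in>B. cis (g b))" if "finite B" for B :: "'a set" and g
    using that by (induction B rule: finite_induct) (auto simp: cis_mult[symmetric])
  then show ?thesis
    by (simp add: euclidean_inner[of \<xi> x] flip: sum_negf)
qed

definition fejer_kernel :: "'a::euclidean_space \<Rightarrow> complex" where
  "fejer_kernel x = (\<Prod>b\<in>Basis. of_real (fejer (x \<bullet> b)))"

lemma continuous_fejer_kernel: "continuous_on UNIV fejer_kernel"
  unfolding fejer_kernel_def[abs_def]
  by (intro continuous_intros continuous_on_compose2[OF continuous_fejer]) auto

lemma integrable_fejer_kernel: "integrable lborel fejer_kernel"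
  unfolding fejer_kernel_def[abs_def]
  using integrable_fejer by (intro integrable_prod_Basis) simp

lemma integral_fejer_kernel: "(LINT x|lborel. fejer_kernel (x::'a::euclidean_space)) \<noteq> 0"
  unfolding fejer_kernel_def
  using fejer_mass_pos integrable_fejer
  by (subst integral_prod_Basis) (auto simp: fejer_mass_def)

lemma norm_fejer_kernel_le_1: "norm (fejer_kernel x) \<le> 1"
  unfolding fejer_kernel_def
  by (subst prod_norm[symmetric], rule prod_le_1) (simp add: fejer_nonneg fejer_le_1)

lemma fejer_kernel_0: "fejer_kernel 0 = 1"
  by (simp add: fejer_kernel_def fejer_def)

lemma norm_cis_minus_1: "(norm (cis s - 1))\<^sup>2 = s\<^sup>2 * fejer s"
proof -
  have "(norm (cis s - 1))\<^sup>2 = ((cos s)\<^sup>2 + (sin s)\<^sup>2) - 2 * cos s + 1"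
    by (simp add: cmod_def power2_eq_square algebra_simps)
  then show ?thesis by (simp add: fejer_mult_square)
qed

text \<open>A Riemann sum for \<open>\<integral>\<^sub>0\<^sup>1 cis (s t) ds\<close>, whose modulus squared is \<open>fejer t\<close>. The sum is a trigonometric
  polynomial, which is how band-limitation of the Fejer kernel is seen.\<close>

definition dirichlet_mean :: "nat \<Rightarrow> real \<Rightarrow> complex" where
  "dirichlet_mean N t = (\<Sum>k\<le>N. cis (real k * (t / Suc N))) / of_nat (Suc N)"

lemma norm_dirichlet_mean: "norm (dirichlet_mean N t) \<le> 1"
proof -
  have "norm (\<Sum>k\<le>N. cis (real k * (t / Suc N))) \<le> (\<Sum>k\<le>N. 1)"
    by (rule order_trans[OF norm_sum]) simp
  then show ?thesis by (simp add: dirichlet_mean_def norm_divide del: of_nat_Suc)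
qed

text \<open>Summing the geometric series gives \<open>\<bar>D\<^sub>N(t)\<bar>\<^sup>2 = fejer t / fejer (t / (N + 1))\<close>, and \<open>fejer\<close> is \<open>1\<close> at the
  origin.\<close>

lemma dirichlet_mean_tendsto:
  "(\<lambda>N. (norm (dirichlet_mean N t))\<^sup>2) \<longlonglongrightarrow> fejer t"
proof (cases "t = 0")
  case True
  have "dirichlet_mean N 0 = 1" for N
    by (simp add: dirichlet_mean_def del: of_nat_Suc) 
  with True show ?thesis by (simp add: fejer_def)
next
  case False
  have "(\<lambda>N. t / Suc N) \<longlonglongrightarrow> 0" by real_asymp
  then have lim: "(\<lambda>N. fejer (t / Suc N)) \<longlonglongrightarrow> fejer 0"
    using continuous_fejer
    by (auto simp: continuous_on_eq_continuous_at intro!: isCont_tendsto_compose[of 0 fejer])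
  then have ev: "\<forall>\<^sub>F N in sequentially. fejer (t / Suc N) \<noteq> 0"
    by (rule tendsto_imp_eventually_ne) (simp add: fejer_def)
  have "(\<lambda>N. fejer t / fejer (t / Suc N)) \<longlonglongrightarrow> fejer t / fejer 0"
    by (intro tendsto_divide tendsto_const lim) (simp add: fejer_def)
  moreover have "\<forall>\<^sub>F N in sequentially. fejer t / fejer (t / Suc N) = (norm (dirichlet_mean N t))\<^sup>2"
    using ev
  proof eventually_elim
    case (elim N)
    define s where "s = t / Suc N"
    have ts: "t = Suc N * s" by (simp add: s_def)
    have "s\<^sup>2 * fejer s \<noteq> 0" using elim False by (simp add: s_def)
    then have ne: "cis s \<noteq> 1" using norm_cis_minus_1[of s] by auto
    have "(\<Sum>k\<le>N. cis (real k * s)) = (\<Sum>k<Suc N. cis s ^ k)"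
      by (simp add: Complex.DeMoivre lessThan_Suc_atMost)
    also have "\<dots> = (cis s ^ Suc N - 1) / (cis s - 1)"
      by (rule geometric_sum[OF ne])
    also have "cis s ^ Suc N = cis t"
      by (simp only: Complex.DeMoivre ts)
    finally have "dirichlet_mean N t = (cis t - 1) / ((cis s - 1) * of_nat (Suc N))"
      by (simp add: dirichlet_mean_def s_def del: of_nat_Suc)
    then have "(norm (dirichlet_mean N t))\<^sup>2 = (norm (cis t - 1))\<^sup>2 / ((norm (cis s - 1))\<^sup>2 * (Suc N)\<^sup>2)"
      by (simp add: norm_divide norm_mult power_divide power_mult_distrib del: of_nat_Suc)
    also have "\<dots> = t\<^sup>2 * fejer t / (t\<^sup>2 * fejer s)"
      unfolding norm_cis_minus_1 by (simp add: s_def power_divide del: of_nat_Suc)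
    also have "\<dots> = fejer t / fejer s" using False by simp
    finally show ?case by (simp add: s_def)
  qed
  ultimately show ?thesis
    using tendsto_cong by (fastforce simp: fejer_def)
qed

lemma dirichlet_mean_trig_poly:
  fixes b :: "'a::euclidean_space"
  assumes "norm b = 1"
  shows "(\<lambda>x. of_real ((norm (dirichlet_mean N (x \<bullet> b)))\<^sup>2)) \<in> trig_poly (cball 0 2)"
proof -
  let ?c = "1 / of_nat (Suc N) :: complex"
  have D: "dirichlet_mean N (x \<bullet> b) = (\<Sum>k\<le>N. ?c * cis (((real k / Suc N) *\<^sub>R b) \<bullet> x))" for x
    unfolding dirichlet_mean_def
    by (simp add: sum_divide_distrib inner_commute del: of_nat_Suc)
  have D': "cnj (dirichlet_mean N (x \<bullet> b)) = (\<Sum>k\<le>N. ?c * cis ((- (real k / Suc N) *\<^sub>R b) \<bullet> x))" for x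
    unfolding D by (simp add: cis_cnj del: of_nat_Suc)
  have "(\<lambda>x. dirichlet_mean N (x \<bullet> b)) \<in> trig_poly (cball 0 1)"
    unfolding D using assms by (intro trig_poly_sum trig_poly_char) (auto simp: field_simps)
  moreover have "(\<lambda>x. cnj (dirichlet_mean N (x \<bullet> b))) \<in> trig_poly (cball 0 1)"
    unfolding D' using assms by (intro trig_poly_sum trig_poly_char) (auto simp: field_simps)
  ultimately have "(\<lambda>x. dirichlet_mean N (x \<bullet> b) * cnj (dirichlet_mean N (x \<bullet> b))) \<in> trig_poly (cball 0 2)"
    by (rule trig_poly_mult) (use norm_triangle_mono[of _ 1 _ 1] in auto)
  then show ?thesis
    by (simp add: complex_norm_square del: of_real_power)
qed

text \<open>Each of the \<open>DIM('a)\<close> factors is approximated by \<open>D\<^sub>N\<close> times its conjugate, with frequencies of norm at most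
  \<open>2\<close>.\<close>

lemma bandlimited_fejer_kernel:
  "bandlimited (cball 0 (2 * DIM('a))) (fejer_kernel :: 'a::euclidean_space \<Rightarrow> complex)"
  unfolding bandlimited_def
proof (intro exI conjI allI)
  let ?p = "\<lambda>N x. \<Prod>b\<in>Basis. complex_of_real ((norm (dirichlet_mean N (x \<bullet> b)))\<^sup>2)"
  show "?p N \<in> trig_poly (cball 0 (2 * DIM('a)) :: 'a set)" for N
    using trig_poly_prod_cball[of "Basis :: 'a set" "\<lambda>b x. of_real ((norm (dirichlet_mean N (x \<bullet> b)))\<^sup>2)" 2]
    by (simp add: dirichlet_mean_trig_poly mult.commute del: of_real_power)
  show "norm (?p N (x::'a)) \<le> 1" for N x
    by (subst prod_norm[symmetric], rule prod_le_1) (simp add: norm_power power_le_one norm_dirichlet_mean)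
  show "(\<lambda>N. ?p N (x::'a)) \<longlonglongrightarrow> fejer_kernel x" for x
    unfolding fejer_kernel_def by (intro tendsto_intros dirichlet_mean_tendsto)
qed

definition plateau_kernel :: "'a::euclidean_space \<Rightarrow> complex" where
  "plateau_kernel x = (\<Prod>b\<in>Basis. of_real (vallee_poussin (x \<bullet> b)))"

lemma integrable_plateau_kernel: "integrable lborel plateau_kernel"
  unfolding plateau_kernel_def[abs_def]
  using integrable_vallee_poussin by (intro integrable_prod_Basis) simp

lemma plateau_kernel_bounded:
  obtains C where "\<And>x::'a::euclidean_space. norm (plateau_kernel x) \<le> C"
proof
  fix x :: 'a
  have *: "\<bar>vallee_poussin t\<bar> \<le> 5 / fejer_mass" for t
  proof -
    have "\<bar>4 * fejer (2 * t) - fejer t\<bar> \<le> 5"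
      using fejer_nonneg[of t] fejer_nonneg[of "2 * t"] fejer_le_1[of t] fejer_le_1[of "2 * t"] by linarith
    then show ?thesis
      unfolding vallee_poussin_def abs_divide using fejer_mass_pos by (simp add: divide_right_mono)
  qed
  have "norm (plateau_kernel x) = (\<Prod>b\<in>Basis. \<bar>vallee_poussin (x \<bullet> b)\<bar>)"
    unfolding plateau_kernel_def by (subst prod_norm[symmetric]) (rule prod.cong, auto)
  also have "\<dots> \<le> (\<Prod>b\<in>(Basis::'a set). 5 / fejer_mass)"
    by (rule prod_mono) (simp add: *)
  finally show "norm (plateau_kernel x) \<le> (\<Prod>b\<in>(Basis::'a set). 5 / fejer_mass)" .
qed

lemma fourier_plateau_kernel:
  fixes \<xi> :: "'a::euclidean_space"
  assumes "norm \<xi> \<le> 1"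
  shows "fourier plateau_kernel \<xi> = 1"
proof -
  have eq: "plateau_kernel x * cis (- (\<xi> \<bullet> x))
      = (\<Prod>b\<in>Basis. of_real (vallee_poussin (x \<bullet> b)) * cis (- ((\<xi> \<bullet> b) * (x \<bullet> b))))" for x
    by (simp add: plateau_kernel_def cis_inner_Basis prod.distrib)
  have b: "\<bar>\<xi> \<bullet> b\<bar> \<le> 1" if "b \<in> Basis" for b
    using Basis_le_norm[OF that, of \<xi>] assms by simp
  have [measurable]: "vallee_poussin \<in> borel_measurable borel"
    unfolding vallee_poussin_def[abs_def] by measurable
  have "integrable lborel (\<lambda>t. of_real (vallee_poussin t) * cis (- ((\<xi> \<bullet> b) * t)))" if "b \<in> Basis" for b
    using fourier_vallee_poussin[OF b[OF that]] not_integrable_integral_eq by fastforce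
  then have "fourier plateau_kernel \<xi> = (\<Prod>b\<in>Basis. (LINT t|lborel. of_real (vallee_poussin t) * cis (- ((\<xi> \<bullet> b) * t))))"
    unfolding fourier_def eq by (rule integral_prod_Basis)
  also have "\<dots> = 1" using b by (simp add: fourier_vallee_poussin)
  finally show ?thesis .
qed

section \<open>Wiener's approximation theorem\<close>

lemma measurable_cis_inner [measurable]: "(\<lambda>x::'a::euclidean_space. cis (\<xi> \<bullet> x)) \<in> borel_measurable borel"
  by (intro borel_measurable_continuous_onI) (simp add: cis_conv_exp continuous_intros)

lemma measurable_cis_minus_inner [measurable]: "(\<lambda>x::'a::euclidean_space. cis (- (\<xi> \<bullet> x))) \<in> borel_measurable borel"
  using measurable_cis_inner[of "- \<xi>"] by simp

lemma integrable_tensor: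
  fixes f g :: "'a::euclidean_space \<Rightarrow> complex"
  assumes f: "integrable lborel f" and g: "integrable lborel g"
  shows "integrable (lborel \<Otimes>\<^sub>M lborel) (\<lambda>(w, z). f w * g z)"
proof -
  have [measurable]: "f \<in> borel_measurable borel" "g \<in> borel_measurable borel"
    using f g by (simp_all add: integrable_iff_bounded)
  show ?thesis
  proof (rule lborel_pair.Fubini_integrable)
    show "(\<lambda>(w, z). f w * g z) \<in> borel_measurable (lborel \<Otimes>\<^sub>M lborel)"
      by measurable
    show "integrable lborel (\<lambda>w. LINT z|lborel. norm (case (w, z) of (w, z) \<Rightarrow> f w * g z))"
      using f by (simp add: norm_mult)
    show "AE w in lborel. integrable lborel (\<lambda>z. case (w, z) of (w, z) \<Rightarrow> f w * g z)"
      using g by simp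
  qed
qed

text \<open>The weight \<open>\<phi>\<close> allows to compare \<open>conv a g\<close> with a multiple of \<open>g\<close> when \<open>g\<close> is modulated: translating
  such a \<open>g\<close> by \<open>y\<close> approximately multiplies it by a character at \<open>y\<close>.\<close>

lemma L1_norm_conv_diff:
  fixes a g \<phi> :: "'a::euclidean_space \<Rightarrow> complex"
  assumes a: "integrable lborel a" and g: "integrable lborel g"
    and ag: "\<And>x. integrable lborel (\<lambda>y. a y * g (x - y))"
    and \<phi>: "\<phi> \<in> borel_measurable borel" "\<And>x. norm (\<phi> x) \<le> 1"
  shows "L1_norm (\<lambda>x. conv a g x - (LINT y|lborel. a y * \<phi> y) * g x)
      \<le> (LINT y|lborel. norm (a y) * L1_norm (\<lambda>x. g (x - y) - \<phi> y * g x))"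
proof -
  have a\<phi>: "integrable lborel (\<lambda>y. a y * \<phi> y)"
    using \<phi> by (intro integrable_bounded_mult2[OF a, where C=1]) auto
  define H where "H = (\<lambda>y x. a y * g (x - y) - (a y * \<phi> y) * g x)"
  have "integrable (lborel \<Otimes>\<^sub>M lborel) (\<lambda>(y, x). H y x)"
    using Bochner_Integration.integrable_diff[OF integrable_conv_kernel[OF a g] integrable_tensor[OF a\<phi> g]]
    by (simp add: H_def case_prod_unfold)
  from integral_norm_kernel_le[OF this]
  have "L1_norm (\<lambda>x. LINT y|lborel. H y x) \<le> (LINT y|lborel. L1_norm (H y))" .
  also have "(\<lambda>x. LINT y|lborel. H y x) = (\<lambda>x. conv a g x - (LINT y|lborel. a y * \<phi> y) * g x)"
    using ag a\<phi> by (simp add: H_def conv_def)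
  also have "(\<lambda>y. L1_norm (H y)) = (\<lambda>y. norm (a y) * L1_norm (\<lambda>x. g (x - y) - \<phi> y * g x))"
  proof -
    have "norm (H y x) = norm (a y) * norm (g (x - y) - \<phi> y * g x)" for x y
      by (simp add: H_def algebra_simps flip: norm_mult)
    then show ?thesis by (simp add: L1_norm_def)
  qed
  finally show ?thesis .
qed

text \<open>A kernel whose Fourier transform is \<open>1\<close> on the ball of radius \<open>r\<close> around \<open>\<xi>\<close>.\<close>

definition local_plateau :: "real \<Rightarrow> 'a::euclidean_space \<Rightarrow> 'a \<Rightarrow> complex" where
  "local_plateau r \<xi> x = of_real (r ^ DIM('a)) * cis (\<xi> \<bullet> x) * plateau_kernel (r *\<^sub>R x)"

lemma measurable_plateau_kernel [measurable]:
  "(plateau_kernel :: 'a::euclidean_space \<Rightarrow> complex) \<in> borel_measurable borel"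
  using borel_measurable_integrable[OF integrable_plateau_kernel[where 'a='a]] by simp

lemma measurable_local_plateau [measurable]: "local_plateau r \<xi> \<in> borel_measurable borel"
  unfolding local_plateau_def[abs_def] by measurable

lemma local_plateau_bounded:
  obtains C where "\<And>x::'a::euclidean_space. norm (local_plateau r \<xi> x) \<le> C"
proof -
  obtain C where C: "\<And>x::'a. norm (plateau_kernel x) \<le> C" using plateau_kernel_bounded by blast
  have "norm (local_plateau r \<xi> (x::'a)) \<le> \<bar>r\<bar> ^ DIM('a) * C" for x
    using C[of "r *\<^sub>R x"] by (simp add: local_plateau_def norm_mult norm_power power_abs mult_left_mono)
  with that show ?thesis by blast
qed

lemma integrable_local_plateau:
  assumes "r > 0" shows "integrable lborel (local_plateau r (\<xi>::'a::euclidean_space))"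
proof -
  have "integrable lborel (\<lambda>x::'a. plateau_kernel (0 + r *\<^sub>R x))"
    using assms by (intro integrable_affine integrable_plateau_kernel) auto
  then have "integrable lborel (\<lambda>x::'a. cis (\<xi> \<bullet> x) * plateau_kernel (r *\<^sub>R x))"
    by (intro integrable_bounded_mult[where C=1]) auto
  then show ?thesis unfolding local_plateau_def[abs_def] mult.assoc by (rule integrable_mult_right)
qed

lemma fourier_local_plateau:
  fixes \<xi> :: "'a::euclidean_space"
  assumes r: "r > 0" and \<eta>: "\<eta> \<in> cball \<xi> r"
  shows "fourier (local_plateau r \<xi>) \<eta> = 1"
proof -
  let ?F = "\<lambda>y. plateau_kernel y * cis (- (((\<eta> - \<xi>) /\<^sub>R r) \<bullet> y))"
  have F: "local_plateau r \<xi> x * cis (- (\<eta> \<bullet> x)) = \<bar>r\<bar> ^ DIM('a) *\<^sub>R ?F (0 + r *\<^sub>R x)" for x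
  proof -
    have "((\<eta> - \<xi>) /\<^sub>R r) \<bullet> (r *\<^sub>R x) = \<eta> \<bullet> x - \<xi> \<bullet> x"
      using r by (simp add: inner_diff_left)
    then have "cis (- (((\<eta> - \<xi>) /\<^sub>R r) \<bullet> (r *\<^sub>R x))) = cis (\<xi> \<bullet> x) * cis (- (\<eta> \<bullet> x))"
      by (simp add: cis_mult)
    then show ?thesis using r by (simp add: local_plateau_def scaleR_conv_of_real)
  qed
  have "fourier (local_plateau r \<xi>) \<eta> = fourier plateau_kernel ((\<eta> - \<xi>) /\<^sub>R r)"
    unfolding fourier_def F using integral_affine[of r ?F 0] r by simp
  also have "\<dots> = 1"
    using r \<eta> by (intro fourier_plateau_kernel) (simp add: dist_norm norm_minus_commute divide_simps)
  finally show ?thesis .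
qed

text \<open>Modulation by \<open>\<xi>\<close> and dilation by \<open>r\<close> are undone inside the \<open>L\<^sup>1\<close> norm, which leaves translates of the fixed
  kernel by \<open>r *\<^sub>R y\<close>.\<close>

lemma L1_norm_local_plateau:
  fixes a :: "'a::euclidean_space \<Rightarrow> complex"
  assumes a: "integrable lborel a" and r: "r > 0" and fourier: "fourier a \<xi> = 1"
  shows "L1_norm (\<lambda>x. conv a (local_plateau r \<xi>) x - local_plateau r \<xi> x)
     \<le> (LINT y|lborel. norm (a y) * L1_norm (\<lambda>x. plateau_kernel (x - r *\<^sub>R y) - plateau_kernel x))"
proof -
  obtain C where C: "\<And>x::'a. norm (local_plateau r \<xi> x) \<le> C" using local_plateau_bounded by blast
  have "L1_norm (\<lambda>x. local_plateau r \<xi> (x - y) - cis (- (\<xi> \<bullet> y)) * local_plateau r \<xi> x)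
     = L1_norm (\<lambda>x. plateau_kernel (x - r *\<^sub>R y) - plateau_kernel x)" for y
  proof -
    let ?F = "\<lambda>x. norm (plateau_kernel (x - r *\<^sub>R y) - plateau_kernel x)"
    have "norm (local_plateau r \<xi> (x - y) - cis (- (\<xi> \<bullet> y)) * local_plateau r \<xi> x)
        = \<bar>r\<bar> ^ DIM('a) *\<^sub>R ?F (0 + r *\<^sub>R x)" for x
    proof -
      have c: "cis (\<xi> \<bullet> (x - y)) = cis (- (\<xi> \<bullet> y)) * cis (\<xi> \<bullet> x)"
        by (simp add: cis_mult inner_diff_right)
      have "local_plateau r \<xi> (x - y) - cis (- (\<xi> \<bullet> y)) * local_plateau r \<xi> x
        = of_real (r ^ DIM('a)) * cis (\<xi> \<bullet> (x - y)) * (plateau_kernel (r *\<^sub>R x - r *\<^sub>R y) - plateau_kernel (r *\<^sub>R x))"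
        unfolding local_plateau_def c by (simp add: algebra_simps)
      then show ?thesis by (simp add: norm_mult norm_power power_abs)
    qed
    then show ?thesis
      unfolding L1_norm_def using integral_affine[of r ?F 0] r by simp
  qed
  moreover have "(LINT y|lborel. a y * cis (- (\<xi> \<bullet> y))) = 1"
    using fourier by (simp add: fourier_def)
  ultimately show ?thesis
    using L1_norm_conv_diff[OF a integrable_local_plateau[OF r, of \<xi>], of "\<lambda>y. cis (- (\<xi> \<bullet> y))"]
      integrable_conv_bounded2[OF measurable_local_plateau C a]
    by simp
qed

text \<open>The Fejer kernel, dilated and normalised to integral \<open>1\<close>.\<close>

definition fejer_identity :: "nat \<Rightarrow> 'a::euclidean_space \<Rightarrow> complex" where
  "fejer_identity n x = of_real (real (Suc n) ^ DIM('a)) / (LINT y::'a|lborel. fejer_kernel y)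
     * fejer_kernel (real (Suc n) *\<^sub>R x)"

lemma integrable_fejer_identity: "integrable lborel (fejer_identity n :: 'a::euclidean_space \<Rightarrow> complex)"
proof -
  have "integrable lborel (\<lambda>x::'a. fejer_kernel (0 + real (Suc n) *\<^sub>R x))"
    by (intro integrable_affine integrable_fejer_kernel) auto
  then show ?thesis unfolding fejer_identity_def[abs_def] by (intro integrable_mult_right) simp
qed

lemma bandlimited_fejer_identity:
  "bandlimited (cball 0 (real (Suc n) * (2 * DIM('a)))) (fejer_identity n :: 'a::euclidean_space \<Rightarrow> complex)"
proof -
  let ?S = "cball 0 (real (Suc n) * (2 * DIM('a))) :: 'a set"
  have "bandlimited ?S (\<lambda>x::'a. fejer_kernel (real (Suc n) *\<^sub>R x))"
    by (rule bandlimited_scale[OF bandlimited_fejer_kernel])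
      (auto simp del: of_nat_Suc intro!: mult_left_mono)
  from bandlimited_mult_char[OF this, of 0 ?S "of_real (real (Suc n) ^ DIM('a)) / (LINT y::'a|lborel. fejer_kernel y)"]
  show ?thesis
    unfolding fejer_identity_def[abs_def] by (simp del: of_nat_Suc)
qed

lemma fejer_identity_tendsto:
  fixes g :: "'a::euclidean_space \<Rightarrow> complex"
  assumes g: "integrable lborel g"
  shows "(\<lambda>n. L1_norm (\<lambda>x. conv (fejer_identity n) g x - g x)) \<longlonglongrightarrow> 0"
proof -
  define c where "c = (LINT y::'a|lborel. fejer_kernel y)"
  have c: "c \<noteq> 0" unfolding c_def by (rule integral_fejer_kernel)
  have le: "L1_norm (\<lambda>x. conv (fejer_identity n) g x - g x)
     \<le> (LINT y|lborel. norm (fejer_kernel y) * L1_norm (\<lambda>x. g (x - (1 / Suc n) *\<^sub>R y) - g x)) / norm c" for n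
  proof -
    define R where "R = real (Suc n)"
    have R: "R > 0" by (simp add: R_def)
    note K = integrable_fejer_identity[of n, where 'a='a] 
    have fi: "fejer_identity n y = \<bar>R\<bar> ^ DIM('a) *\<^sub>R (fejer_kernel (0 + R *\<^sub>R y) / c)" for y :: 'a
      using R unfolding fejer_identity_def R_def[symmetric] c_def[symmetric]
      by (simp add: scaleR_conv_of_real)
    have "(LINT y::'a|lborel. fejer_identity n y * 1) = (LINT y::'a|lborel. fejer_kernel y / c)"
      unfolding fi using integral_affine[of R "\<lambda>y::'a. fejer_kernel y / c" 0] R by simp
    also have "\<dots> = 1" using c by (simp add: c_def)
    finally have one: "(LINT y::'a|lborel. fejer_identity n y * 1) = 1" .
    obtain C where C: "\<And>x::'a. norm (fejer_identity n x) \<le> C"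
      using bandlimited_bounded[OF bandlimited_fejer_identity] by blast
    have "L1_norm (\<lambda>x. conv (fejer_identity n) g x - (LINT y::'a|lborel. fejer_identity n y * 1) * g x)
      \<le> (LINT y|lborel. norm (fejer_identity n y) * L1_norm (\<lambda>x. g (x - y) - 1 * g x))"
    proof (rule L1_norm_conv_diff[OF K g, where \<phi>="\<lambda>_. 1"])
      show "integrable lborel (\<lambda>y. fejer_identity n y * g (x - y))" for x
        using K by (intro integrable_conv_bounded[OF _ C g]) (simp add: integrable_iff_bounded)
    qed auto
    also have "\<dots> = (LINT y|lborel. norm (fejer_kernel y / c) * L1_norm (\<lambda>x. g (x - (1/R) *\<^sub>R y) - g x))"
      using integral_affine[of R "\<lambda>y. norm (fejer_kernel y / c) * L1_norm (\<lambda>x. g (x - (1/R) *\<^sub>R y) - g x)" 0] R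
      by (simp add: fi mult.assoc)
    finally show ?thesis
      unfolding one R_def[symmetric] by (simp add: norm_divide)
  qed
  have "(\<lambda>n. 1 / real (Suc n)) \<longlonglongrightarrow> 0" by real_asymp
  from tendsto_divide[OF integral_translate_diff_tendsto[OF integrable_fejer_kernel g this] tendsto_const[of "norm c"]]
  have "(\<lambda>n. (LINT y|lborel. norm (fejer_kernel y) * L1_norm (\<lambda>x. g (x - (1 / Suc n) *\<^sub>R y) - g x)) / norm c) \<longlonglongrightarrow> 0"
    using c by simp
  then show ?thesis
    by (rule tendsto_sandwich[OF _ _ tendsto_const, rotated 2]) (use le in auto)
qed

text \<open>If the Fourier transform of \<open>g\<close> vanishes, convolution with \<open>g\<close> kills band-limited functions, in particular the
  approximate identity.\<close>

theorem fourier_zero_imp_AE_zero: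
  fixes g :: "'a::euclidean_space \<Rightarrow> complex"
  assumes g: "integrable lborel g" and fourier: "\<And>\<xi>. fourier g \<xi> = 0"
  shows "AE x in lborel. g x = 0"
proof -
  have "conv (fejer_identity n) g x = 0" for n x
    using conv_bandlimited[OF g fourier bandlimited_fejer_identity, of n x]
    by (simp add: conv_commute)
  then have "L1_norm g = 0"
    using fejer_identity_tendsto[OF g] by (simp add: L1_norm_def LIMSEQ_const_iff)
  then show ?thesis using L1_norm_eq_0_iff[OF g] by simp
qed

text \<open>The elements are functions, not classes: \<open>L1_norm\<close> is a seminorm, so the closedness condition also makes the ideal
  invariant under changes on null sets.\<close>

locale closed_L1_ideal =
  fixes I :: "('a::euclidean_space \<Rightarrow> complex) set"
  assumes integrable: "g \<in> I \<Longrightarrow> integrable lborel g"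
    and add: "g \<in> I \<Longrightarrow> h \<in> I \<Longrightarrow> (\<lambda>x. g x + h x) \<in> I"
    and scale: "g \<in> I \<Longrightarrow> (\<lambda>x. c * g x) \<in> I"
    and conv: "g \<in> I \<Longrightarrow> integrable lborel b \<Longrightarrow> conv g b \<in> I"
    and closed: "integrable lborel g \<Longrightarrow> (\<And>e. e > 0 \<Longrightarrow> \<exists>k\<in>I. L1_norm (\<lambda>x. g x - k x) < e) \<Longrightarrow> g \<in> I"
begin

lemma dominated_limit:
  assumes k: "\<And>n::nat. k n \<in> I" and lim: "\<And>x. (\<lambda>n. k n x) \<longlonglongrightarrow> g x"
    and w: "integrable lborel w" "\<And>n x. norm (k n x) \<le> w x"
  shows "g \<in> I"
proof (rule closed)
  have m[measurable]: "k n \<in> borel_measurable lborel" for n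
    using integrable[OF k] by auto
  have g_m[measurable]: "g \<in> borel_measurable lborel"
    using lim m by (rule borel_measurable_LIMSEQ_metric[rotated])
  show g: "integrable lborel g"
    by (rule integrable_dominated_convergence[where s=k and w=w]) (use w lim in auto)
  have "(\<lambda>n. LINT x|lborel. norm (g x - k n x)) \<longlonglongrightarrow> (LINT x::'a|lborel. (0::real))"
  proof (rule integral_dominated_convergence[where w="\<lambda>x. norm (g x) + w x"])
    show "AE x in lborel. (\<lambda>n. norm (g x - k n x)) \<longlonglongrightarrow> 0"
      using lim by (intro AE_I2) (auto intro!: tendsto_eq_intros)
    show "AE x in lborel. norm (norm (g x - k n x)) \<le> norm (g x) + w x" for n
      using w(2) by (intro AE_I2) (auto intro: order_trans[OF norm_triangle_ineq4] add_left_mono)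
  qed (use g w in auto)
  then have conv: "(\<lambda>n. L1_norm (\<lambda>x. g x - k n x)) \<longlonglongrightarrow> 0"
    by (simp add: L1_norm_def)
  fix e :: real assume "e > 0"
  then obtain n where "L1_norm (\<lambda>x. g x - k n x) < e"
    using LIMSEQ_D[OF conv, of e] by auto
  then show "\<exists>k\<in>I. L1_norm (\<lambda>x. g x - k x) < e" using k by blast
qed

text \<open>Let \<open>v\<close> be the plateau kernel of a ball around \<open>\<xi>\<close>, so that \<open>v * g = g\<close> if \<open>g\<close> has its frequencies there. Then
  \<open>g - a * g = h * g\<close> with \<open>h = v - a * v\<close>, and \<open>h\<close> has \<open>L\<^sup>1\<close> norm less than \<open>1\<close> once the ball is
  small. Iterating \<open>g \<mapsto> g - a * g\<close> therefore tends to \<open>0\<close>, while each step changes the function by an element of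
  the ideal; so \<open>g\<close> is a limit of elements of the ideal.\<close>

lemma local_membership:
  assumes a: "a \<in> I" and fourier: "fourier a \<xi> = 1"
  shows "\<exists>r>0. \<forall>g. integrable lborel g \<and> bandlimited (cball \<xi> r) g \<longrightarrow> g \<in> I"
proof -
  have ai: "integrable lborel a" using a by (rule integrable)
  have "(\<lambda>n. 1 / real (Suc n)) \<longlonglongrightarrow> 0" by real_asymp
  from LIMSEQ_D[OF integral_translate_diff_tendsto[OF ai integrable_plateau_kernel this], of 1]
  obtain n where n: "(LINT y|lborel. norm (a y) * L1_norm (\<lambda>x. plateau_kernel (x - (1 / real (Suc n)) *\<^sub>R y) - plateau_kernel x)) < 1"
    by (auto dest!: spec)
  define r where "r = 1 / real (Suc n)"
  have r: "r > 0" by (simp add: r_def)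
  define v where "v = local_plateau r \<xi>"
  define q where "q = L1_norm (\<lambda>x. conv a v x - v x)"
  have q1: "q < 1"
    using L1_norm_local_plateau[OF ai r fourier] n unfolding q_def v_def r_def by linarith
  have q0: "0 \<le> q" by (simp add: q_def)
  have vi: "integrable lborel v" unfolding v_def by (rule integrable_local_plateau[OF r])
  (* what the iteration preserves; boundedness is a hypothesis of conv_assoc *)
  define P where "P = (\<lambda>g. integrable lborel g \<and> (\<exists>C. \<forall>x. norm (g x) \<le> C) \<and> conv v g = g)"
  define T where "T = (\<lambda>g x. g x - conv a g x)"
  have T: "P (T g) \<and> L1_norm (T g) \<le> q * L1_norm g" if Pg: "P g" for g
  proof -
    have gi: "integrable lborel g" and vg: "conv v g = g"
      using Pg unfolding P_def by blast+
    obtain C where C: "\<And>x. norm (g x) \<le> C"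
      using Pg unfolding P_def by blast
    have gm: "g \<in> borel_measurable borel" using gi by (simp add: integrable_iff_bounded)
    have agm: "conv a g \<in> borel_measurable borel"
      using ai gm by (intro borel_measurable_conv) (auto simp: integrable_iff_bounded)
    have agC: "norm (conv a g x) \<le> C * L1_norm a" for x
      using norm_conv_le[OF gm C ai] by (simp add: conv_commute)
    have avg: "conv (conv a v) g = conv a g"
      using conv_assoc[OF ai vi gm C] vg by simp
    have "conv v (conv a g) = conv (conv v a) g"
      using conv_assoc[OF vi ai gm C] by simp
    then have vag: "conv v (conv a g) = conv a g"
      using avg by (simp add: conv_commute)
    have h: "conv (\<lambda>x. v x - conv a v x) g x = T g x" for x
    proof -
      have "conv (\<lambda>x. v x - conv a v x) g x = conv v g x - conv (conv a v) g x"
        unfolding conv_def[of _ g] left_diff_distrib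
        by (intro Bochner_Integration.integral_diff integrable_conv_bounded2[OF gm C] vi integrable_conv[OF ai vi])
      then show ?thesis by (simp add: T_def vg avg)
    qed
    have "conv v (T g) x = conv v g x - conv v (conv a g) x" for x
      unfolding conv_def[of v] T_def right_diff_distrib
      by (intro Bochner_Integration.integral_diff integrable_conv_bounded2[OF gm C]
          integrable_conv_bounded2[OF agm agC] vi)
    then have "conv v (T g) = T g"
      by (auto simp: vg vag T_def)
    moreover have "norm (T g x) \<le> C + C * L1_norm a" for x
      unfolding T_def using C[of x] agC[of x] by (meson add_mono norm_triangle_ineq4 order_trans)
    moreover have "integrable lborel (T g)"
      unfolding T_def by (intro Bochner_Integration.integrable_diff gi integrable_conv ai)
    moreover have "L1_norm (T g) \<le> q * L1_norm g"
    proof -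
      have "T g = conv (\<lambda>x. v x - conv a v x) g" by (simp add: fun_eq_iff h)
      then have "L1_norm (T g) \<le> L1_norm (\<lambda>x. v x - conv a v x) * L1_norm g"
        using L1_norm_conv[of "\<lambda>x. v x - conv a v x" g] vi gi integrable_conv[OF ai vi] by simp
      then show ?thesis by (simp add: q_def L1_norm_minus[of v])
    qed
    ultimately show ?thesis unfolding P_def by blast
  qed
  have "g \<in> I" if gi: "integrable lborel g" and gb: "bandlimited (cball \<xi> r) g" for g
  proof -
    have "conv v g x = 1 * g x" for x
      using gb r unfolding v_def by (intro conv_bandlimited integrable_local_plateau fourier_local_plateau) auto
    then have P0: "P g"
      unfolding P_def using gi bandlimited_bounded[OF gb] by (metis ext mult_1)
    define G where "G = (\<lambda>n. (T ^^ n) g)"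
    have G: "P (G n) \<and> L1_norm (G n) \<le> q ^ n * L1_norm g \<and> (\<lambda>x. g x - G n x) \<in> I" for n
    proof (induction n)
      case 0
      then show ?case using P0 scale[OF a, of 0] by (simp add: G_def)
    next
      case (Suc n)
      have S: "G (Suc n) = T (G n)" by (simp add: G_def)
      have "L1_norm (T (G n)) \<le> q * L1_norm (G n)" using Suc T by blast
      also have "\<dots> \<le> q * (q ^ n * L1_norm g)" using Suc q0 by (intro mult_left_mono) auto
      finally have "L1_norm (T (G n)) \<le> q ^ Suc n * L1_norm g" by (simp add: mult.assoc)
      moreover have "(\<lambda>x. (g x - G n x) + conv a (G n) x) \<in> I"
        using Suc by (intro add conv a) (auto simp: P_def)
      then have "(\<lambda>x. g x - G (Suc n) x) \<in> I"
        by (simp add: S T_def algebra_simps)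
      ultimately show ?case using Suc T S by auto
    qed
    show "g \<in> I"
    proof (rule closed[OF gi])
      fix e :: real assume "e > 0"
      have "(\<lambda>n. q ^ n * L1_norm g) \<longlonglongrightarrow> 0 * L1_norm g"
        using q0 q1 by (intro tendsto_mult_right LIMSEQ_realpow_zero)
      then obtain n where n: "q ^ n * L1_norm g < e"
        using LIMSEQ_D[of "\<lambda>n. q ^ n * L1_norm g" 0 e] \<open>e > 0\<close> q0 by (auto simp: abs_mult)
      have "L1_norm (\<lambda>x. g x - (g x - G n x)) = L1_norm (G n)" by simp
      then have "L1_norm (\<lambda>x. g x - (g x - G n x)) < e"
        using G[of n] n by linarith
      then show "\<exists>k\<in>I. L1_norm (\<lambda>x. g x - k x) < e"
        using G[of n] by (intro bexI[where x="\<lambda>x. g x - G n x"]) simp_all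
    qed
  qed
  with r show ?thesis by blast
qed

text \<open>A Lebesgue number for the cover of the ball by the balls of \<open>local_membership\<close>.\<close>

lemma uniform_local_membership:
  assumes fourier: "\<And>\<xi>. \<exists>a\<in>I. fourier a \<xi> \<noteq> 0"
  obtains r where "r > 0"
    "\<And>\<xi> g. \<xi> \<in> cball 0 R \<Longrightarrow> integrable lborel g \<Longrightarrow> bandlimited (cball \<xi> r) g \<Longrightarrow> g \<in> I"
proof -
  have "\<exists>r>0. \<forall>g. integrable lborel g \<and> bandlimited (cball \<xi> r) g \<longrightarrow> g \<in> I" for \<xi>
  proof -
    obtain a where a: "a \<in> I" "fourier a \<xi> \<noteq> 0" using fourier by blast
    have "fourier (\<lambda>x. 1 / fourier a \<xi> * a x) \<xi> = 1"
      using a(2) unfolding fourier_def[of "\<lambda>x. 1 / fourier a \<xi> * a x"] mult.assoc by (simp add: fourier_def)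
    then show ?thesis using local_membership[OF scale[OF a(1)]] by blast
  qed
  then obtain \<rho> where \<rho>: "\<And>\<xi>. \<rho> \<xi> > 0"
    "\<And>\<xi> g. integrable lborel g \<Longrightarrow> bandlimited (cball \<xi> (\<rho> \<xi>)) g \<Longrightarrow> g \<in> I"
    by metis
  have "cball 0 R \<subseteq> \<Union>(range (\<lambda>\<xi>. ball \<xi> (\<rho> \<xi>)))" using \<rho>(1) centre_in_ball by blast
  then obtain e where e: "e > 0" "\<forall>x\<in>cball 0 R. \<exists>G\<in>range (\<lambda>\<xi>. ball \<xi> (\<rho> \<xi>)). ball x e \<subseteq> G"
    by (rule Heine_Borel_lemma[OF compact_cball]) auto
  show ?thesis
  proof
    show "e / 2 > 0" using e by simp
    fix x :: 'a and g assume x: "x \<in> cball 0 R" and g: "integrable lborel g" "bandlimited (cball x (e/2)) g"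
    from bspec[OF e(2) x] obtain \<xi> where "ball x e \<subseteq> ball \<xi> (\<rho> \<xi>)" by auto
    moreover have "cball x (e/2) \<subseteq> ball x e" using e(1) by auto
    ultimately have "cball x (e/2) \<subseteq> cball \<xi> (\<rho> \<xi>)" using ball_subset_cball by blast
    then show "g \<in> I" using \<rho>(2)[OF g(1)] bandlimited_mono[OF g(2)] by blast
  qed
qed

text \<open>The Fejer kernel \<open>K m\<close> is dilated until its frequencies lie in a ball whose radius is uniform over all frequencies
  of \<open>g\<close>. The product of a character with \<open>K m\<close> then has its frequencies in a single such ball, hence lies in the
  ideal; so do products with trigonometric polynomials, and with \<open>g\<close>. As the dilation factor tends to \<open>0\<close>,
  \<open>K m\<close> tends to \<open>1\<close> and \<open>g\<close> itself is reached.\<close>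

lemma bandlimited_membership:
  assumes fourier: "\<And>\<xi>. \<exists>a\<in>I. fourier a \<xi> \<noteq> 0"
    and g: "integrable lborel g" and b: "bandlimited (cball 0 R) g"
  shows "g \<in> I"
proof -
  obtain r where r: "r > 0"
    "\<And>\<xi> g. \<xi> \<in> cball 0 R \<Longrightarrow> integrable lborel g \<Longrightarrow> bandlimited (cball \<xi> r) g \<Longrightarrow> g \<in> I"
    using uniform_local_membership[OF fourier] by blast
  define \<rho> where "\<rho> = (\<lambda>m. r / (2 * DIM('a)) / real (Suc m))"
  have \<rho>: "\<rho> m > 0" "\<rho> m * (2 * DIM('a)) \<le> r" for m
  proof -
    have D: "real DIM('a) > 0" by simp
    then show "\<rho> m > 0" using r unfolding \<rho>_def by (intro divide_pos_pos) auto
    have "\<rho> m * (2 * DIM('a)) = r / real (Suc m)" using D by (simp add: \<rho>_def)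
    also have "\<dots> \<le> r / 1" using r by (intro divide_left_mono) auto
    finally show "\<rho> m * (2 * DIM('a)) \<le> r" by simp
  qed
  define K where "K = (\<lambda>m x::'a. fejer_kernel (\<rho> m *\<^sub>R x))"
  have Ki: "integrable lborel (K m)" for m
    using integrable_affine[OF integrable_fejer_kernel, of "\<rho> m" "0::'a"] \<rho>(1)[of m] by (simp add: K_def)
  have Kb: "bandlimited (cball 0 r) (K m)" for m
    unfolding K_def
  proof (rule bandlimited_scale[OF bandlimited_fejer_kernel])
    fix s :: 'a assume "s \<in> cball 0 (2 * DIM('a))"
    then have "\<rho> m * norm s \<le> \<rho> m * (2 * DIM('a))"
      using \<rho>(1)[of m] by (intro mult_left_mono) auto
    also have "\<dots> \<le> r" by (rule \<rho>(2))
    finally show "\<rho> m *\<^sub>R s \<in> cball 0 r" using \<rho>(1)[of m] by simp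
  qed
  obtain a0 where "a0 \<in> I" using fourier by blast
  then have zero: "(\<lambda>_. 0) \<in> I" using scale[of a0 0] by simp
  have pK: "(\<lambda>x. p x * K m x) \<in> I" if "p \<in> trig_poly (cball 0 R)" for p m
    using that
  proof (induction p rule: trig_poly.induct)
    case zero
    then show ?case using \<open>(\<lambda>_. 0) \<in> I\<close> by simp
  next
    case (add_char p \<xi> c)
    have "(\<lambda>x. c * cis (\<xi> \<bullet> x) * K m x) \<in> I"
    proof (rule r(2)[OF add_char.hyps(2)])
      show "integrable lborel (\<lambda>x. c * cis (\<xi> \<bullet> x) * K m x)"
        by (rule integrable_bounded_mult[OF Ki, where C="norm c"]) (auto simp: norm_mult)
      show "bandlimited (cball \<xi> r) (\<lambda>x. c * cis (\<xi> \<bullet> x) * K m x)"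
        by (rule bandlimited_mult_char[OF Kb]) (simp add: dist_norm)
    qed
    from add[OF add_char.IH this] show ?case by (simp add: algebra_simps)
  qed
  obtain p C where p: "\<And>n::nat. p n \<in> trig_poly (cball 0 R)" "\<And>n x. norm (p n x) \<le> C"
    "\<And>x. (\<lambda>n. p n x) \<longlonglongrightarrow> g x" using b by (rule bandlimitedE) blast
  have gK: "(\<lambda>x. g x * K m x) \<in> I" for m
  proof (rule dominated_limit)
    show "(\<lambda>x. p n x * K m x) \<in> I" for n by (rule pK[OF p(1)])
    show "(\<lambda>n. p n x * K m x) \<longlonglongrightarrow> g x * K m x" for x by (intro tendsto_intros p(3))
    show "integrable lborel (\<lambda>x. C * norm (K m x))" using Ki by simp
    show "norm (p n x * K m x) \<le> C * norm (K m x)" for n x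
      using p(2) by (simp add: norm_mult mult_right_mono)
  qed
  show "g \<in> I"
  proof (rule dominated_limit)
    show "(\<lambda>x. g x * K m x) \<in> I" for m by (rule gK)
    show "(\<lambda>m. g x * K m x) \<longlonglongrightarrow> g x" for x
    proof -
      have "\<rho> \<longlonglongrightarrow> 0" unfolding \<rho>_def by real_asymp
      from tendsto_scaleR[OF this tendsto_const, of x] have \<rho>x: "(\<lambda>m. \<rho> m *\<^sub>R x) \<longlonglongrightarrow> 0" by simp
      have "isCont fejer_kernel (0::'a)"
        using continuous_fejer_kernel continuous_on_eq_continuous_at by blast
      from isCont_tendsto_compose[OF this \<rho>x] have "(\<lambda>m. K m x) \<longlonglongrightarrow> fejer_kernel (0::'a)"
        unfolding K_def .
      from tendsto_mult_left[OF this, of "g x"] show ?thesis by (simp add: fejer_kernel_0)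
    qed
    show "integrable lborel (\<lambda>x. norm (g x))" using g by simp
    show "norm (g x * K m x) \<le> norm (g x)" for m x
      using norm_fejer_kernel_le_1[of "\<rho> m *\<^sub>R x"] by (simp add: norm_mult K_def mult_left_le)
  qed
qed

text \<open>The approximate identity is band-limited, so it lies in the ideal, and with it all its convolutions with \<open>g\<close>.\<close>

theorem Wiener_tauberian:
  assumes fourier: "\<And>\<xi>. \<exists>a\<in>I. fourier a \<xi> \<noteq> 0" and g: "integrable lborel g"
  shows "g \<in> I"
proof (rule closed[OF g])
  fix e :: real assume "e > 0"
  then obtain n where n: "L1_norm (\<lambda>x. conv (fejer_identity n) g x - g x) < e"
    using LIMSEQ_D[OF fejer_identity_tendsto[OF g], of e] by auto
  have "conv (fejer_identity n) g \<in> I"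
    by (intro conv bandlimited_membership[OF fourier _ bandlimited_fejer_identity] integrable_fejer_identity g)
  then show "\<exists>k\<in>I. L1_norm (\<lambda>x. g x - k x) < e"
    using n L1_norm_minus[of g] by auto
qed

end

section \<open>Convolutions with a bounded function\<close>

lemma conv_translate: "conv F g (z - y) = conv F (\<lambda>x. g (x - y)) z"
  by (simp add: conv_def algebra_simps)

lemma conv_diff_right:
  fixes F :: "'a::euclidean_space \<Rightarrow> complex"
  assumes F: "F \<in> borel_measurable borel" "\<And>x. norm (F x) \<le> C"
    and g: "integrable lborel g" and h: "integrable lborel h"
  shows "conv F (\<lambda>x. g x - h x) z = conv F g z - conv F h z"
  unfolding conv_def right_diff_distrib
  by (intro Bochner_Integration.integral_diff integrable_conv_bounded[OF F] g h)

lemma norm_conv_diff_le: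
  fixes F :: "'a::euclidean_space \<Rightarrow> complex"
  assumes F: "F \<in> borel_measurable borel" "\<And>x. norm (F x) \<le> C"
    and g: "integrable lborel g" and h: "integrable lborel h"
  shows "norm (conv F g z - conv F h z) \<le> C * L1_norm (\<lambda>x. g x - h x)"
  using norm_conv_le[OF F, of "\<lambda>x. g x - h x" z] conv_diff_right[OF F g h] g h by simp

lemma continuous_conv:
  fixes F :: "'a::euclidean_space \<Rightarrow> complex"
  assumes F: "F \<in> borel_measurable borel" "\<And>x. norm (F x) \<le> C" and g: "integrable lborel g"
  shows "continuous_on UNIV (conv F g)"
proof (rule continuous_at_imp_continuous_on, rule ballI)
  fix z :: 'a
  have "(\<lambda>n. conv F g (u n)) \<longlonglongrightarrow> conv F g z" if u: "u \<longlonglongrightarrow> z" for u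
  proof -
    have y: "(\<lambda>n. z - u n) \<longlonglongrightarrow> 0"
      using tendsto_diff[OF tendsto_const u, of z] by simp
    have "norm (conv F g (u n) - conv F g z) \<le> C * L1_norm (\<lambda>x. g (x - (z - u n)) - g x)" for n
      using norm_conv_diff_le[OF F integrable_translate[OF g, of "z - u n"] g, of z]
        conv_translate[of F g z "z - u n"] by simp
    moreover have "(\<lambda>n. C * L1_norm (\<lambda>x. g (x - (z - u n)) - g x)) \<longlonglongrightarrow> 0"
      using tendsto_mult_left[OF L1_norm_translate_diff_tendsto[OF g y], of C] by simp
    ultimately have "(\<lambda>n. conv F g (u n) - conv F g z) \<longlonglongrightarrow> 0"
      by (rule Lim_null_comparison[OF always_eventually[OF allI]])
    then show ?thesis by (simp add: LIM_zero_iff)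
  qed
  then show "isCont (conv F g) z"
    by (simp add: continuous_at_sequentially comp_def)
qed

lemma tendsto_at_infinity_sequentially:
  fixes f :: "'a::real_normed_vector \<Rightarrow> 'b::metric_space"
  assumes "\<And>z::nat \<Rightarrow> 'a. filterlim z at_infinity sequentially \<Longrightarrow> (\<lambda>n. f (z n)) \<longlonglongrightarrow> l"
  shows "(f \<longlongrightarrow> l) at_infinity"
proof (rule tendstoI, rule ccontr)
  fix e :: real assume e: "e > 0" "\<not> (\<forall>\<^sub>F x in at_infinity. dist (f x) l < e)"
  then have "\<forall>n::nat. \<exists>x. norm x \<ge> real n \<and> dist (f x) l \<ge> e"
    unfolding eventually_at_infinity by (metis not_le)
  then obtain z where z: "\<And>n::nat. norm (z n) \<ge> real n" "\<And>n. dist (f (z n)) l \<ge> e" by metis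
  have "filterlim (\<lambda>n. norm (z n)) at_top sequentially"
    by (rule filterlim_at_top_mono[OF filterlim_real_sequentially]) (simp add: z)
  then have "filterlim z at_infinity sequentially"
    by (rule filterlim_norm_at_top_imp_at_infinity)
  from tendstoD[OF assms[OF this] e(1)] have "\<forall>\<^sub>F n in sequentially. dist (f (z n)) l < e" .
  then show False using z(2) by (simp add: not_le[symmetric])
qed

text \<open>By dominated convergence along sequences; the filter \<open>at_infinity\<close> is countably generated.\<close>

lemma conv_tendsto_0_at_infinity:
  fixes u :: "'a::euclidean_space \<Rightarrow> complex"
  assumes u[measurable]: "u \<in> borel_measurable borel" and uC: "\<And>x. norm (u x) \<le> C"
    and lim: "(u \<longlongrightarrow> 0) at_infinity" and b: "integrable lborel b"
  shows "(conv u b \<longlongrightarrow> 0) at_infinity"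
proof (rule tendsto_at_infinity_sequentially)
  fix z :: "nat \<Rightarrow> 'a" assume z: "filterlim z at_infinity sequentially"
  have [measurable]: "b \<in> borel_measurable borel" using b by (simp add: integrable_iff_bounded)
  have "(\<lambda>n. LINT w|lborel. b w * u (z n - w)) \<longlonglongrightarrow> (LINT w::'a|lborel. (0::complex))"
  proof (rule integral_dominated_convergence[where w="\<lambda>w. norm (b w) * C"])
    show "AE w in lborel. (\<lambda>n. b w * u (z n - w)) \<longlonglongrightarrow> 0"
    proof (rule AE_I2)
      fix w
      have "filterlim (\<lambda>n. - w + z n) at_infinity sequentially"
        by (rule tendsto_add_filterlim_at_infinity[OF tendsto_const z])
      then have "(\<lambda>n. u (z n - w)) \<longlonglongrightarrow> 0"
        using filterlim_compose[OF lim] by fastforce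
      then show "(\<lambda>n. b w * u (z n - w)) \<longlonglongrightarrow> 0"
        using tendsto_mult_left[of _ 0 _ "b w"] by fastforce
    qed
    show "AE w in lborel. norm (b w * u (z n - w)) \<le> norm (b w) * C" for n
      by (auto simp: norm_mult intro!: mult_left_mono uC)
  qed (use b in auto)
  then show "(\<lambda>n. conv u b (z n)) \<longlonglongrightarrow> 0"
    by (simp add: conv_commute[of u b]) (simp add: conv_def)
qed

definition vanishing :: "('a::euclidean_space \<Rightarrow> complex) \<Rightarrow> ('a \<Rightarrow> complex) set" where
  "vanishing F = {g. integrable lborel g \<and> (conv F g \<longlongrightarrow> 0) at_infinity}"

lemma closed_L1_ideal_vanishing:
  fixes F :: "'a::euclidean_space \<Rightarrow> complex"
  assumes F: "F \<in> borel_measurable borel" "\<And>x. norm (F x) \<le> C"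
  shows "closed_L1_ideal (vanishing F)"
proof
  show "integrable lborel g" if "g \<in> vanishing F" for g
    using that by (simp add: vanishing_def)
  have C: "C \<ge> 0" using F(2)[of 0] norm_ge_zero order_trans by blast
  show "(\<lambda>x. g x + h x) \<in> vanishing F" if "g \<in> vanishing F" "h \<in> vanishing F" for g h
  proof -
    have i: "integrable lborel g" "integrable lborel h" using that by (auto simp: vanishing_def)
    have "conv F (\<lambda>x. g x + h x) = (\<lambda>z. conv F g z + conv F h z)"
      unfolding conv_def distrib_left
      by (intro ext Bochner_Integration.integral_add integrable_conv_bounded[OF F] i)
    then show ?thesis
      using that tendsto_add[of "conv F g" 0 at_infinity "conv F h" 0] by (simp add: vanishing_def)
  qed
  show "(\<lambda>x. c * g x) \<in> vanishing F" if "g \<in> vanishing F" for g c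
  proof -
    have "conv F (\<lambda>x. c * g x) = (\<lambda>z. c * conv F g z)"
      by (simp add: conv_def[abs_def] mult.left_commute)
    then show ?thesis
      using that tendsto_mult_left[of "conv F g" 0 at_infinity c] by (simp add: vanishing_def)
  qed
  show "conv g b \<in> vanishing F" if "g \<in> vanishing F" and b: "integrable lborel b" for g b
  proof -
    have g: "integrable lborel g" "(conv F g \<longlongrightarrow> 0) at_infinity" using that by (auto simp: vanishing_def)
    have "conv F (conv g b) = conv (conv F g) b"
      by (rule conv_assoc_bounded[OF g(1) b F])
    moreover have "(conv (conv F g) b \<longlongrightarrow> 0) at_infinity"
    proof (rule conv_tendsto_0_at_infinity[OF _ norm_conv_le[OF F g(1)] g(2) b])
      show "conv F g \<in> borel_measurable borel"
        using F g by (intro borel_measurable_conv) (auto simp: integrable_iff_bounded)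
    qed
    ultimately show ?thesis using g b integrable_conv by (simp add: vanishing_def)
  qed
  show "g \<in> vanishing F" if g: "integrable lborel g"
    and approx: "\<And>e. e > 0 \<Longrightarrow> \<exists>k\<in>vanishing F. L1_norm (\<lambda>x. g x - k x) < e" for g
  proof -
    have "(conv F g \<longlongrightarrow> 0) at_infinity"
    proof (rule tendstoI)
      fix e :: real assume e: "e > 0"
      define d where "d = e / (2 * (C + 1))"
      have d: "d > 0" "C * d < e / 2" using e C by (auto simp: d_def field_simps add_pos_nonneg)
      obtain k where k: "k \<in> vanishing F" "L1_norm (\<lambda>x. g x - k x) < d" using approx[OF d(1)] by blast
      have ki: "integrable lborel k" "(conv F k \<longlongrightarrow> 0) at_infinity" using k by (auto simp: vanishing_def)
      have "\<forall>\<^sub>F z in at_infinity. dist (conv F k z) 0 < e / 2"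
        using tendstoD[OF ki(2), of "e/2"] e by simp
      then show "\<forall>\<^sub>F z in at_infinity. dist (conv F g z) 0 < e"
      proof eventually_elim
        case (elim z)
        have "norm (conv F g z) \<le> norm (conv F g z - conv F k z) + norm (conv F k z)"
          using norm_triangle_ineq[of "conv F g z - conv F k z" "conv F k z"] by simp
        also have "norm (conv F g z - conv F k z) \<le> C * L1_norm (\<lambda>x. g x - k x)"
          by (rule norm_conv_diff_le[OF F g ki(1)])
        also have "\<dots> \<le> C * d" using k C by (intro mult_left_mono) auto
        finally show ?case using elim d by simp
      qed
    qed
    then show ?thesis using g by (simp add: vanishing_def)
  qed
qed

lemma vanishing_eq_L1:
  fixes F :: "'a::euclidean_space \<Rightarrow> complex"
  assumes F: "F \<in> borel_measurable borel" "\<And>x. norm (F x) \<le> C"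
    and fourier: "\<And>\<xi>. \<exists>a\<in>vanishing F. fourier a \<xi> \<noteq> 0" and g: "integrable lborel g"
  shows "g \<in> vanishing F"
  using closed_L1_ideal.Wiener_tauberian[OF closed_L1_ideal_vanishing[OF F] fourier g] by blast

section \<open>Schwartz functions\<close>

lemma Schwartz_continuous:
  assumes "\<phi> \<in> Schwartz" shows "continuous_on UNIV \<phi>"
proof -
  have "\<phi> differentiable (at x)" for x
    using assms unfolding Schwartz_def by (auto dest: spec[of _ "[]"])
  then show ?thesis
    by (simp add: continuous_on_eq_continuous_at differentiable_imp_continuous_within)
qed

lemma Schwartz_decay:
  assumes "\<phi> \<in> Schwartz"
  obtains C where "\<And>x. (1 + norm x) ^ k * norm (\<phi> x) \<le> C"
proof -
  have "bounded (range (\<lambda>x. (1 + norm x) ^ k *\<^sub>R \<phi> x))"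
    using assms unfolding Schwartz_def by (auto dest: spec[of _ "[]"])
  then obtain C where "\<forall>y\<in>range (\<lambda>x. (1 + norm x) ^ k *\<^sub>R \<phi> x). norm y \<le> C"
    unfolding bounded_iff by blast
  then have "(1 + norm x) ^ k * norm (\<phi> x) \<le> C" for x
    by (auto simp: norm_power)
  with that show ?thesis by blast
qed

text \<open>The product of the functions \<open>1 / (1 + x\<^sub>b\<^sup>2)\<close> over the coordinates is integrable, and it is at least
  \<open>(1 + norm x) ^ (- 2 DIM('a))\<close>.\<close>

lemma integrable_decay:
  fixes \<phi> :: "'a::euclidean_space \<Rightarrow> complex"
  assumes m: "\<phi> \<in> borel_measurable borel"
    and C: "\<And>x. (1 + norm x) ^ (2 * DIM('a)) * norm (\<phi> x) \<le> C"
  shows "integrable lborel \<phi>"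
proof (rule Bochner_Integration.integrable_bound)
  let ?u = "\<lambda>x::'a. \<Prod>b\<in>Basis. complex_of_real (inverse (1 + (x \<bullet> b)\<^sup>2))"
  have "integrable lborel ?u"
    using integrable_inverse_one_plus_square by (intro integrable_prod_Basis) (simp only: complex_of_real_integrable_eq)
  then show "integrable lborel (\<lambda>x. C *\<^sub>R ?u x)" by simp
  show "AE x in lborel. norm (\<phi> x) \<le> norm (C *\<^sub>R ?u x)"
  proof (rule AE_I2)
    fix x :: 'a
    let ?p = "\<Prod>b\<in>(Basis::'a set). 1 + (x \<bullet> b)\<^sup>2"
    have pos: "?p > 0" by (intro prod_pos) (simp add: add_pos_nonneg)
    have "?p \<le> (\<Prod>b\<in>(Basis::'a set). (1 + norm x)\<^sup>2)"
    proof (rule prod_mono, intro conjI)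
      fix b :: 'a assume "b \<in> Basis"
      then have "(x \<bullet> b)\<^sup>2 \<le> (norm x)\<^sup>2" using Basis_le_norm[of b x] by (simp add: abs_le_square_iff[symmetric])
      then show "1 + (x \<bullet> b)\<^sup>2 \<le> (1 + norm x)\<^sup>2"
        by (simp add: power2_sum add_increasing2)
    qed simp
    also have "\<dots> = (1 + norm x) ^ (2 * DIM('a))" by (simp add: power_mult)
    finally have "?p * norm (\<phi> x) \<le> C"
      using C[of x] mult_right_mono[of ?p _ "norm (\<phi> x)"] by fastforce
    then have "norm (\<phi> x) \<le> C * inverse ?p" using pos by (simp add: field_simps)
    also have "\<dots> \<le> \<bar>C\<bar> * inverse ?p" using pos by (intro mult_right_mono) auto
    also have "inverse ?p = norm (?u x)"
      by (subst prod_norm[symmetric], subst prod_inversef[symmetric], rule prod.cong) (auto simp: add_nonneg_nonneg norm_inverse simp del: of_real_add)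
    finally show "norm (\<phi> x) \<le> norm (C *\<^sub>R ?u x)" by simp
  qed
qed (use m in simp)

lemma integrable_Schwartz:
  fixes \<phi> :: "'a::euclidean_space \<Rightarrow> complex"
  assumes "\<phi> \<in> Schwartz" shows "integrable lborel \<phi>"
  using Schwartz_decay[OF assms, of "2 * DIM('a)"] integrable_decay
    borel_measurable_continuous_onI[OF Schwartz_continuous[OF assms]] by blast

lemma integrable_Schwartz_moment:
  fixes \<phi> :: "'a::euclidean_space \<Rightarrow> complex"
  assumes "\<phi> \<in> Schwartz" shows "integrable lborel (\<lambda>x. of_real (norm x) * \<phi> x)"
proof -
  obtain C where C: "\<And>x. (1 + norm x) ^ Suc (2 * DIM('a)) * norm (\<phi> x) \<le> C"
    using Schwartz_decay[OF assms] by blast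
  show ?thesis
  proof (rule integrable_decay)
    have [measurable]: "\<phi> \<in> borel_measurable borel"
      by (rule borel_measurable_continuous_onI[OF Schwartz_continuous[OF assms]])
    show "(\<lambda>x. of_real (norm x) * \<phi> x) \<in> borel_measurable borel" by measurable
    fix x :: 'a
    have "(1 + norm x) ^ (2 * DIM('a)) * norm (of_real (norm x) * \<phi> x)
       = norm x * ((1 + norm x) ^ (2 * DIM('a)) * norm (\<phi> x))" by (simp add: norm_mult)
    also have "\<dots> \<le> (1 + norm x) * ((1 + norm x) ^ (2 * DIM('a)) * norm (\<phi> x))"
      by (intro mult_right_mono) auto
    also have "\<dots> \<le> C" using C[of x] by (simp add: mult.assoc)
    finally show "(1 + norm x) ^ (2 * DIM('a)) * norm (of_real (norm x) * \<phi> x) \<le> C" .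
  qed
qed

definition gaussian :: "'a::euclidean_space \<Rightarrow> complex" where
  "gaussian x = of_real (exp (- (x \<bullet> x) / 2))"

text \<open>Directional derivatives of polynomials are polynomials; this keeps iterated partial derivatives of the Gaussian in the
  class of polynomials times the Gaussian.\<close>

lemma real_polynomial_function_directional:
  fixes P :: "'a::euclidean_space \<Rightarrow> real"
  assumes "real_polynomial_function P"
  shows "\<exists>Q. real_polynomial_function Q \<and> (\<forall>x. \<exists>D. (P has_derivative D) (at x) \<and> D b = Q x)"
  using assms
proof (induction P rule: real_polynomial_function.induct)
  case (linear f)
  then have "\<forall>x. (f has_derivative f) (at x)" by (simp add: bounded_linear_imp_has_derivative)
  then show ?case by (intro exI[of _ "\<lambda>_. f b"]) auto
next
  case (const c)
  show ?case by (intro exI[of _ "\<lambda>_. 0"]) (auto intro!: exI[of _ "\<lambda>_. 0"])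
next
  case (add f g)
  then obtain Q R where Q: "real_polynomial_function Q" "\<And>x. \<exists>D. (f has_derivative D) (at x) \<and> D b = Q x"
    and R: "real_polynomial_function R" "\<And>x. \<exists>D. (g has_derivative D) (at x) \<and> D b = R x" by blast
  show ?case
  proof (rule exI[of _ "\<lambda>x. Q x + R x"], intro conjI allI)
    fix x
    obtain D E where "(f has_derivative D) (at x)" "D b = Q x" "(g has_derivative E) (at x)" "E b = R x"
      using Q(2)[of x] R(2)[of x] by blast
    then show "\<exists>D. ((\<lambda>x. f x + g x) has_derivative D) (at x) \<and> D b = Q x + R x"
      by (intro exI[of _ "\<lambda>h. D h + E h"] conjI has_derivative_add) auto
  qed (use Q R in auto)
next
  case (mult f g)
  then obtain Q R where Q: "real_polynomial_function Q" "\<And>x. \<exists>D. (f has_derivative D) (at x) \<and> D b = Q x"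
    and R: "real_polynomial_function R" "\<And>x. \<exists>D. (g has_derivative D) (at x) \<and> D b = R x" by blast
  show ?case
  proof (rule exI[of _ "\<lambda>x. f x * R x + Q x * g x"], intro conjI allI)
    fix x
    obtain D E where "(f has_derivative D) (at x)" "D b = Q x" "(g has_derivative E) (at x)" "E b = R x"
      using Q(2)[of x] R(2)[of x] by blast
    then show "\<exists>D. ((\<lambda>x. f x * g x) has_derivative D) (at x) \<and> D b = f x * R x + Q x * g x"
      by (intro exI[of _ "\<lambda>h. f x * E h + D h * g x"] conjI has_derivative_mult) auto
  qed (use Q R mult in auto)
qed

lemma real_polynomial_function_growth:
  fixes P :: "'a::euclidean_space \<Rightarrow> real"
  assumes "real_polynomial_function P"
  shows "\<exists>C m. \<forall>x. \<bar>P x\<bar> \<le> C * (1 + norm x) ^ m"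
  using assms
proof (induction P rule: real_polynomial_function.induct)
  case (linear f)
  then obtain K where K: "K > 0" "\<And>x. norm (f x) \<le> norm x * K" using bounded_linear.pos_bounded by blast
  have "\<bar>f x\<bar> \<le> K * (1 + norm x) ^ 1" for x
    using K(2)[of x] K(1) by (simp add: algebra_simps)
  then show ?case by blast
next
  case (const c)
  have "\<bar>c\<bar> \<le> \<bar>c\<bar> * (1 + norm x) ^ 0" for x :: 'a by simp
  then show ?case by blast
next
  case (add f g)
  then obtain C m D n where fg: "\<And>x. \<bar>f x\<bar> \<le> C * (1 + norm x) ^ m" "\<And>x. \<bar>g x\<bar> \<le> D * (1 + norm x) ^ n" by blast
  have "\<bar>f x + g x\<bar> \<le> (\<bar>C\<bar> + \<bar>D\<bar>) * (1 + norm x) ^ (m + n)" for x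
  proof -
    have "\<bar>f x\<bar> \<le> \<bar>C\<bar> * (1 + norm x) ^ (m + n)"
      by (rule order_trans[OF fg(1)]) (intro mult_mono power_increasing, auto)
    moreover have "\<bar>g x\<bar> \<le> \<bar>D\<bar> * (1 + norm x) ^ (m + n)"
      by (rule order_trans[OF fg(2)]) (intro mult_mono power_increasing, auto)
    ultimately show ?thesis by (simp add: distrib_right)
  qed
  then show ?case by blast
next
  case (mult f g)
  then obtain C m D n where fg: "\<And>x. \<bar>f x\<bar> \<le> C * (1 + norm x) ^ m" "\<And>x. \<bar>g x\<bar> \<le> D * (1 + norm x) ^ n" by blast
  have "\<bar>f x * g x\<bar> \<le> (C * D) * (1 + norm x) ^ (m + n)" for x
  proof -
    have "\<bar>f x * g x\<bar> \<le> (C * (1 + norm x) ^ m) * (D * (1 + norm x) ^ n)"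
      unfolding abs_mult using fg by (intro mult_mono order_trans[OF abs_ge_zero fg(1)]) auto
    then show ?thesis by (simp add: power_add mult_ac)
  qed
  then show ?case by blast
qed

lemma has_derivative_poly_gaussian:
  fixes P :: "'a::euclidean_space \<Rightarrow> real"
  assumes D: "(P has_derivative D) (at x)"
  shows "((\<lambda>x. of_real (P x) * gaussian x) has_derivative
      (\<lambda>h. of_real (D h - P x * (x \<bullet> h)) * gaussian x)) (at x)"
proof -
  have "((\<lambda>x. P x * exp (- (x \<bullet> x) / 2)) has_derivative
     (\<lambda>h. (D h - P x * (x \<bullet> h)) * exp (- (x \<bullet> x) / 2))) (at x)"
    by (auto intro!: derivative_eq_intros D simp: algebra_simps inner_commute)
  from has_derivative_of_real[OF this] show ?thesis by (simp add: gaussian_def)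
qed

lemma iter_partial_gaussian:
  "\<exists>P. real_polynomial_function P \<and> iter_partial bs gaussian = (\<lambda>x::'a::euclidean_space. of_real (P x) * gaussian x)"
proof (induction bs)
  case Nil
  show ?case by (intro exI[of _ "\<lambda>_. 1"]) auto
next
  case (Cons b bs)
  then obtain P where P: "real_polynomial_function P"
    "iter_partial bs gaussian = (\<lambda>x::'a. of_real (P x) * gaussian x)" by blast
  obtain Q where Q: "real_polynomial_function Q" "\<And>x. \<exists>D. (P has_derivative D) (at x) \<and> D b = Q x"
    using real_polynomial_function_directional[OF P(1)] by blast
  have "frechet_derivative (\<lambda>x. of_real (P x) * gaussian x) (at x) b = of_real (Q x - P x * (x \<bullet> b)) * gaussian x" for x
  proof -
    obtain D where D: "(P has_derivative D) (at x)" "D b = Q x" using Q(2) by blast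
    show ?thesis
      unfolding frechet_derivative_at[OF has_derivative_poly_gaussian[OF D(1)], symmetric]
      by (simp only: D(2))
  qed
  then have "iter_partial (b # bs) gaussian = (\<lambda>x. of_real (Q x - P x * (x \<bullet> b)) * gaussian x)"
    by (simp add: P(2))
  moreover have "real_polynomial_function (\<lambda>x. Q x - P x * (x \<bullet> b))"
    by (rule real_polynomial_function_diff[OF Q(1) real_polynomial_function.intros(4)[OF P(1)
          real_polynomial_function.intros(1)[OF bounded_linear_inner_left]]])
  ultimately show ?case by blast
qed

lemma gaussian_Schwartz: "gaussian \<in> (Schwartz :: ('a::euclidean_space \<Rightarrow> complex) set)"
  unfolding Schwartz_def
proof (intro CollectI allI impI conjI)
  fix bs :: "'a list"
  obtain P where P: "real_polynomial_function P"
    "iter_partial bs gaussian = (\<lambda>x::'a. of_real (P x) * gaussian x)" using iter_partial_gaussian by blast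
  show "iter_partial bs gaussian differentiable (at x)" for x
  proof -
    obtain D where "(P has_derivative D) (at x)"
      using real_polynomial_function_directional[OF P(1)] by blast
    then show ?thesis
      unfolding P(2) differentiable_def using has_derivative_poly_gaussian by blast
  qed
  fix k :: nat
  obtain C m where Cm: "\<And>x. \<bar>P x\<bar> \<le> C * (1 + norm x) ^ m"
    using real_polynomial_function_growth[OF P(1)] by blast
  have C: "C \<ge> 0" using Cm[of 0] by simp
  show "bounded (range (\<lambda>x. (1 + norm x) ^ k *\<^sub>R iter_partial bs gaussian x))"
    unfolding bounded_iff
  proof (intro exI ballI)
    fix y assume "y \<in> range (\<lambda>x. (1 + norm x) ^ k *\<^sub>R iter_partial bs gaussian x)"
    then obtain x where y: "y = (1 + norm x) ^ k *\<^sub>R (of_real (P x) * gaussian x)" by (auto simp: P(2))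
    define N where "N = real (k + m)"
    have "norm y = (1 + norm x) ^ k * (\<bar>P x\<bar> * exp (- (norm x)\<^sup>2 / 2))"
      unfolding y by (simp add: norm_mult norm_power gaussian_def power2_norm_eq_inner)
    also have "\<dots> \<le> (1 + norm x) ^ k * ((C * (1 + norm x) ^ m) * exp (- (norm x)\<^sup>2 / 2))"
      by (intro mult_left_mono mult_right_mono Cm) auto
    also have "\<dots> = C * ((1 + norm x) ^ (k + m) * exp (- (norm x)\<^sup>2 / 2))"
      by (simp add: power_add mult_ac)
    also have "\<dots> \<le> C * (exp (N * norm x) * exp (- (norm x)\<^sup>2 / 2))"
      using C exp_ge_add_one_self[of "norm x"] unfolding N_def exp_of_nat_mult
      by (intro mult_left_mono mult_right_mono power_mono) auto
    (* completing the square in the exponent *)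
    also have "\<dots> = C * exp (N\<^sup>2 / 2 - (norm x - N)\<^sup>2 / 2)"
      by (simp add: mult_exp_exp power2_diff algebra_simps diff_divide_distrib add_divide_distrib)
    also have "\<dots> \<le> C * exp (N\<^sup>2 / 2)"
      using C by (intro mult_left_mono) auto
    finally show "norm y \<le> C * exp ((real (k + m))\<^sup>2 / 2)" by (simp add: N_def)
  qed
qed

text \<open>The transform is a product of values of the characteristic function of the standard normal distribution, each of which is
  an exponential.\<close>

lemma fourier_gaussian_nonzero: "fourier gaussian (\<xi>::'a::euclidean_space) \<noteq> 0"
proof -
  have norm1: "(LINT t|lborel. of_real (exp (- t\<^sup>2 / 2)) * cis (- (s * t))) \<noteq> 0" for s
  proof -
    let ?I = "LINT t|lborel. of_real (exp (- t\<^sup>2 / 2)) * cis (- (s * t))"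
    have "exp (- ((-s)\<^sup>2) / 2) = char std_normal_distribution (-s)"
      by (simp only: char_std_normal_distribution)
    also have "\<dots> = (LINT t|lborel. std_normal_density t *\<^sub>R iexp (- s * t))"
      unfolding char_def by (subst integral_density) (auto simp: normal_density_nonneg)
    also have "\<dots> = (LINT t|lborel. of_real (1 / sqrt (2 * pi)) * (of_real (exp (- t\<^sup>2 / 2)) * cis (- (s * t))))"
      by (simp add: std_normal_density_def scaleR_conv_of_real cis_conv_exp mult_ac)
    also have "\<dots> = of_real (1 / sqrt (2 * pi)) * ?I" by simp
    finally show ?thesis by (metis exp_not_eq_zero mult_zero_right of_real_eq_0_iff)
  qed
  have gauss: "exp (- (x \<bullet> x) / 2) = (\<Prod>b\<in>Basis. exp (- (x \<bullet> b)\<^sup>2 / 2))" for x :: 'a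
    by (simp add: exp_sum[symmetric] euclidean_inner[of x x] sum_negf sum_divide_distrib power2_eq_square)
  have eq: "gaussian x * cis (- (\<xi> \<bullet> x))
      = (\<Prod>b\<in>Basis. of_real (exp (- (x \<bullet> b)\<^sup>2 / 2)) * cis (- ((\<xi> \<bullet> b) * (x \<bullet> b))))" for x
    unfolding gaussian_def gauss of_real_prod cis_inner_Basis by (simp add: prod.distrib)
  (* a function that is not integrable has integral 0 *)
  have "integrable lborel (\<lambda>t. of_real (exp (- t\<^sup>2 / 2)) * cis (- ((\<xi> \<bullet> b) * t)))" for b
    using norm1[of "\<xi> \<bullet> b"] not_integrable_integral_eq by blast
  then have "fourier gaussian \<xi> = (\<Prod>b\<in>Basis. (LINT t|lborel. of_real (exp (- t\<^sup>2 / 2)) * cis (- ((\<xi> \<bullet> b) * t))))"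
    unfolding fourier_def eq by (intro integral_prod_Basis)
  then show ?thesis using norm1 by simp
qed

section \<open>Borel representatives of Lebesgue measurable functions\<close>

lemma complex_borel_representative:
  fixes f :: "'a::euclidean_space \<Rightarrow> complex"
  assumes f: "f \<in> borel_measurable lebesgue"
  obtains f' where "f' \<in> borel_measurable borel" "AE x in lborel. f x = f' x"
proof -
  have "(\<lambda>x. Re (f x)) \<in> borel_measurable lebesgue" "(\<lambda>x. Im (f x)) \<in> borel_measurable lebesgue"
    using f by measurable
  then obtain u v where u: "u \<in> borel_measurable lborel" "AE x in lborel. Re (f x) = u x"
    and v: "v \<in> borel_measurable lborel" "AE x in lborel. Im (f x) = v x"
    using completion_ex_borel_measurable_real by metis
  show ?thesis
  proof
    show "(\<lambda>x. Complex (u x) (v x)) \<in> borel_measurable borel"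
      unfolding Complex_eq using u(1) v(1) by measurable
    show "AE x in lborel. f x = Complex (u x) (v x)"
      using u(2) v(2) by eventually_elim (simp add: complex_eq_iff)
  qed
qed

lemma
  fixes f f' :: "'a::euclidean_space \<Rightarrow> complex"
  assumes f': "f' \<in> borel_measurable borel" and ae: "AE x in lborel. f x = f' x"
  shows lebesgue_integral_representative: "(LINT x|lebesgue. f x) = (LINT x|lborel. f' x)"
    and lebesgue_integrable_representative: "integrable lebesgue f \<longleftrightarrow> integrable lborel f'"
proof -
  have f'L: "f' \<in> borel_measurable lebesgue" using f' by (intro measurable_completion) simp
  have ae': "AE x in lebesgue. f x = f' x" using ae by (rule AE_completion)
  have ae'': "AE x in lebesgue. f' x = f x" using ae' by eventually_elim simp
  have fL: "f \<in> borel_measurable lebesgue" by (rule borel_measurable_AE[OF f'L ae''])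
  have "(LINT x|lebesgue. f x) = (LINT x|lebesgue. f' x)"
    by (rule integral_cong_AE[OF fL f'L ae'])
  then show "(LINT x|lebesgue. f x) = (LINT x|lborel. f' x)"
    using f' by (simp add: integral_completion)
  have "integrable lebesgue f \<longleftrightarrow> integrable lebesgue f'"
    by (rule integrable_cong_AE[OF fL f'L ae'])
  then show "integrable lebesgue f \<longleftrightarrow> integrable lborel f'"
    using f' by (simp add: integrable_completion)
qed

lemma integrable_representative:
  fixes g :: "'a::euclidean_space \<Rightarrow> complex"
  assumes "integrable lebesgue g"
  obtains g' where "integrable lborel g'" "AE x in lborel. g x = g' x"
  using assms complex_borel_representative lebesgue_integrable_representative
  by (metis borel_measurable_integrable)

lemma Linfty_representative:
  fixes f :: "'a::euclidean_space \<Rightarrow> complex"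
  assumes "f \<in> Linfty"
  obtains F C where "F \<in> borel_measurable borel" "\<And>x. norm (F x) \<le> C" "AE x in lborel. f x - A = F x"
proof -
  obtain C where f: "f \<in> borel_measurable lebesgue" and C: "AE x in lebesgue. norm (f x) \<le> C"
    using assms unfolding Linfty_def by blast
  obtain f' where f'[measurable]: "f' \<in> borel_measurable borel" and ae: "AE x in lborel. f x = f' x"
    using complex_borel_representative[OF f] by blast
  define F where "F = (\<lambda>x. if norm (f' x) \<le> C then f' x - A else 0)"
  show ?thesis
  proof
    show "F \<in> borel_measurable borel" unfolding F_def by measurable
    show "norm (F x) \<le> \<bar>C\<bar> + norm A" for x
      unfolding F_def using norm_triangle_ineq4[of "f' x" A] by auto
    show "AE x in lborel. f x - A = F x"
      using ae C[unfolded AE_completion_iff] by eventually_elim (simp add: F_def)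
  qed
qed

lemma AE_reflect:
  fixes P :: "'a::euclidean_space \<Rightarrow> bool"
  assumes "AE x in lborel. P x"
  shows "AE w in lborel. P (z - w)"
proof -
  obtain N where N: "{x. \<not> P x} \<subseteq> N" "N \<in> null_sets lborel"
    using assms unfolding eventually_ae_filter by auto
  have L: "lborel = distr lborel borel (\<lambda>x::'a. z - x)"
    using lborel_affine[of "-1" z] by (simp add: density_1)
  have "AE x in distr lborel borel (\<lambda>x::'a. z - x). x \<notin> N"
    using AE_not_in[OF N(2)] by (subst (asm) L)
  then have "AE w in lborel. z - w \<notin> N"
    using N(2) by (subst (asm) AE_distr_iff) auto
  then show ?thesis by eventually_elim (use N(1) in auto)
qed

text \<open>The constant \<open>A\<close> contributes \<open>A \<cdot> \<integral> g\<close>, so the condition on \<open>f\<close> becomes one on \<open>F = f - A\<close> alone.\<close>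

lemma convolution_representative:
  fixes f g F G :: "'a::euclidean_space \<Rightarrow> complex"
  assumes F: "F \<in> borel_measurable borel" "\<And>x. norm (F x) \<le> C" and f: "AE x in lborel. f x - A = F x"
    and G: "integrable lborel G" and g: "AE x in lborel. g x = G x"
  shows "convolution f g z = A * (LINT x|lebesgue. g x) + conv F G z"
proof -
  note [measurable] = F(1)
  have [measurable]: "G \<in> borel_measurable borel" using G by (simp add: integrable_iff_bounded)
  have "AE w in lborel. f w * g (z - w) = A * G (z - w) + F w * G (z - w)"
    using f AE_reflect[OF g, of z]
  proof eventually_elim
    case (elim w)
    then have "f w = A + F w" by (simp add: algebra_simps)
    with elim show ?case by (simp add: algebra_simps)
  qed
  then have "convolution f g z = (LINT w|lborel. A * G (z - w) + F w * G (z - w))"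
    unfolding Defs.convolution_def by (intro lebesgue_integral_representative) measurable
  also have "\<dots> = (LINT w|lborel. A * G (z - w)) + conv F G z"
    unfolding conv_def
    by (intro Bochner_Integration.integral_add integrable_conv_bounded[OF F G] integrable_mult_right integrable_reflect G)
  also have "(LINT w|lborel. A * G (z - w)) = A * (LINT x|lebesgue. g x)"
    using integral_reflect[of G z] lebesgue_integral_representative[OF _ g] by simp
  finally show ?thesis .
qed

section \<open>The short-time Fourier transform as a convolution\<close>

text \<open>The reflection turns the correlation in the short-time Fourier transform into a convolution. The modulation
  \<open>exp (- 2 \<pi> i \<omega> \<bullet> t)\<close> is moved to the argument \<open>x - t\<close>, at the price of a phase that depends on \<open>x\<close> and \<open>\<omega>\<close>
  only.\<close>

definition stft_window :: "('a::euclidean_space \<Rightarrow> complex) \<Rightarrow> 'a \<Rightarrow> 'a \<Rightarrow> complex" where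
  "stft_window \<Phi> \<omega> y = cnj (\<Phi> (- y)) * cis (2 * pi * (\<omega> \<bullet> y))"

lemma exp_minus_2pi: "exp (- 2 * of_real pi * \<i> * of_real t) = cis (- (2 * pi * t))"
  by (simp add: cis_conv_exp mult_ac)

lemma measurable_stft_window:
  assumes "continuous_on UNIV \<Phi>" shows "stft_window \<Phi> \<omega> \<in> borel_measurable borel"
proof (rule borel_measurable_continuous_onI)
  have "continuous_on UNIV (\<lambda>y. \<Phi> (- y))"
    by (rule continuous_on_compose2[OF assms]) (auto intro: continuous_intros)
  then show "continuous_on UNIV (stft_window \<Phi> \<omega>)"
    unfolding stft_window_def[abs_def] cis_conv_exp by (intro continuous_intros)
qed

lemma norm_STFT:
  fixes f \<Phi> F :: "'a::euclidean_space \<Rightarrow> complex"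
  assumes F[measurable]: "F \<in> borel_measurable borel" and f: "AE x in lborel. f x - A = F x"
    and \<Phi>: "continuous_on UNIV \<Phi>"
  shows "norm (STFT \<Phi> (\<lambda>t. f t - A) x \<omega>) = norm (conv F (stft_window \<Phi> \<omega>) x)"
proof -
  have [measurable]: "\<Phi> \<in> borel_measurable borel" using \<Phi> by (rule borel_measurable_continuous_onI)
  have [measurable]: "stft_window \<Phi> \<omega> \<in> borel_measurable borel" by (rule measurable_stft_window[OF \<Phi>])
  have eq: "(f t - A) * cnj (\<Phi> (t - x)) * exp (- 2 * of_real pi * \<i> * of_real (\<omega> \<bullet> t))
      = cis (- (2 * pi * (\<omega> \<bullet> x))) * (F t * stft_window \<Phi> \<omega> (x - t))" if "f t - A = F t" for t
    using that unfolding exp_minus_2pi stft_window_def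
    by (simp add: algebra_simps inner_diff_right cis_mult)
  have "AE t in lborel. (f t - A) * cnj (\<Phi> (t - x)) * exp (- 2 * of_real pi * \<i> * of_real (\<omega> \<bullet> t))
      = cis (- (2 * pi * (\<omega> \<bullet> x))) * (F t * stft_window \<Phi> \<omega> (x - t))"
    by (intro eventually_mono[OF f] eq)
  then have "STFT \<Phi> (\<lambda>t. f t - A) x \<omega>
      = (LINT t|lborel. cis (- (2 * pi * (\<omega> \<bullet> x))) * (F t * stft_window \<Phi> \<omega> (x - t)))"
    unfolding STFT_def by (intro lebesgue_integral_representative) measurable
  then have "STFT \<Phi> (\<lambda>t. f t - A) x \<omega> = cis (- (2 * pi * (\<omega> \<bullet> x))) * conv F (stft_window \<Phi> \<omega>) x"
    by (simp add: conv_def)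
  then show ?thesis by (simp add: norm_mult)
qed

lemma integrable_stft_window:
  fixes \<Phi> :: "'a::euclidean_space \<Rightarrow> complex"
  assumes "\<Phi> \<in> Schwartz" shows "integrable lborel (stft_window \<Phi> \<omega>)"
proof -
  have "integrable lborel (\<lambda>y. \<Phi> (0 - y))"
    by (intro integrable_reflect integrable_Schwartz assms)
  then have "integrable lborel (\<lambda>y. norm (\<Phi> (- y)))" by simp
  then show ?thesis
    by (rule Bochner_Integration.integrable_bound)
      (use measurable_stft_window[OF Schwartz_continuous[OF assms]] in \<open>auto simp: stft_window_def norm_mult\<close>)
qed

lemma fourier_stft_window: "fourier (stft_window \<Phi> \<omega>) \<xi> = fourier (stft_window \<Phi> 0) (\<xi> - (2 * pi) *\<^sub>R \<omega>)"
  unfolding fourier_def stft_window_def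
  by (simp add: mult.assoc cis_mult inner_diff_left algebra_simps)

lemma fourier_stft_window_nonzero:
  fixes \<Phi> :: "'a::euclidean_space \<Rightarrow> complex"
  assumes \<Phi>: "\<Phi> \<in> Schwartz" "\<Phi> \<noteq> (\<lambda>_. 0)"
  shows "\<exists>\<omega>. fourier (stft_window \<Phi> \<omega>) \<xi> \<noteq> 0"
proof (rule ccontr)
  assume *: "\<not> (\<exists>\<omega>. fourier (stft_window \<Phi> \<omega>) \<xi> \<noteq> 0)"
  have "fourier (stft_window \<Phi> 0) \<eta> = 0" for \<eta>
    using * fourier_stft_window[of \<Phi> "(\<xi> - \<eta>) /\<^sub>R (2 * pi)" \<xi>] by simp
  then have "AE y in lborel. stft_window \<Phi> 0 y = 0"
    by (rule fourier_zero_imp_AE_zero[OF integrable_stft_window[OF \<Phi>(1)]])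
  then have "AE y in lborel. \<Phi> (- y) = 0" by (simp add: stft_window_def)
  moreover have "continuous_on UNIV (\<lambda>y. \<Phi> (- y))"
    by (rule continuous_on_compose2[OF Schwartz_continuous[OF \<Phi>(1)]]) (auto intro: continuous_intros)
  ultimately have "\<Phi> (- y) = 0" for y by (rule continuous_AE_zero[rotated])
  from this[of "- y" for y] show False using \<Phi>(2) by auto
qed

lemma norm_cis_diff_le: "norm (cis s - cis t) \<le> \<bar>s - t\<bar>"
proof -
  have "cis s - cis t = cis t * (cis (s - t) - 1)" by (simp add: algebra_simps cis_mult)
  then have "norm (cis s - cis t) = norm (cis (s - t) - 1)" by (simp add: norm_mult)
  moreover have "(norm (cis (s - t) - 1))\<^sup>2 \<le> \<bar>s - t\<bar>\<^sup>2"
    unfolding norm_cis_minus_1 using fejer_le_1[of "s - t"] by (simp add: mult_left_le)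
  then have "norm (cis (s - t) - 1) \<le> \<bar>s - t\<bar>" by (rule power2_le_imp_le) simp
  ultimately show ?thesis by simp
qed

lemma stft_window_lipschitz:
  fixes \<Phi> :: "'a::euclidean_space \<Rightarrow> complex"
  assumes \<Phi>: "\<Phi> \<in> Schwartz"
  shows "L1_norm (\<lambda>y. stft_window \<Phi> \<omega> y - stft_window \<Phi> \<omega>' y)
    \<le> 2 * pi * dist \<omega> \<omega>' * L1_norm (\<lambda>y. of_real (norm y) * \<Phi> y)"
proof -
  let ?m = "\<lambda>y. of_real (norm y) * \<Phi> y"
  have m: "integrable lborel (\<lambda>y. ?m (0 - y))"
    by (intro integrable_reflect integrable_Schwartz_moment \<Phi>)
  have "norm (stft_window \<Phi> \<omega> y - stft_window \<Phi> \<omega>' y) \<le> 2 * pi * dist \<omega> \<omega>' * norm (?m (0 - y))" for y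
  proof -
    have "norm (stft_window \<Phi> \<omega> y - stft_window \<Phi> \<omega>' y)
       = norm (\<Phi> (- y)) * norm (cis (2 * pi * (\<omega> \<bullet> y)) - cis (2 * pi * (\<omega>' \<bullet> y)))"
      by (simp add: stft_window_def norm_mult flip: right_diff_distrib)
    also have "\<dots> \<le> norm (\<Phi> (- y)) * \<bar>2 * pi * (\<omega> \<bullet> y) - 2 * pi * (\<omega>' \<bullet> y)\<bar>"
      by (intro mult_left_mono norm_cis_diff_le) auto
    also have "\<bar>2 * pi * (\<omega> \<bullet> y) - 2 * pi * (\<omega>' \<bullet> y)\<bar> = 2 * pi * \<bar>(\<omega> - \<omega>') \<bullet> y\<bar>"
      by (simp add: inner_diff_left abs_mult flip: right_diff_distrib)
    also have "norm (\<Phi> (- y)) * \<dots> \<le> norm (\<Phi> (- y)) * (2 * pi * (dist \<omega> \<omega>' * norm y))"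
      by (intro mult_left_mono) (auto simp: dist_norm Cauchy_Schwarz_ineq2)
    finally show ?thesis by (simp add: norm_mult mult_ac)
  qed
  then have "L1_norm (\<lambda>y. stft_window \<Phi> \<omega> y - stft_window \<Phi> \<omega>' y)
     \<le> (LINT y|lborel. 2 * pi * dist \<omega> \<omega>' * norm (?m (0 - y)))"
    unfolding L1_norm_def
    by (intro integral_mono integrable_norm Bochner_Integration.integrable_diff integrable_stft_window \<Phi>
        integrable_mult_right m)
  also have "\<dots> = 2 * pi * dist \<omega> \<omega>' * L1_norm ?m"
    using integral_reflect[of "\<lambda>y. norm (?m y)" 0] by (simp add: L1_norm_def)
  finally show ?thesis .
qed

text \<open>Pointwise convergence on a finite net of the ball, combined with the Lipschitz dependence of the window on \<open>\<omega>\<close>.\<close>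

lemma conv_stft_window_uniform:
  fixes \<Phi> F :: "'a::euclidean_space \<Rightarrow> complex"
  assumes F: "F \<in> borel_measurable borel" "\<And>x. norm (F x) \<le> C" and \<Phi>: "\<Phi> \<in> Schwartz"
    and lim: "\<And>\<omega>. (conv F (stft_window \<Phi> \<omega>) \<longlongrightarrow> 0) at_infinity" and e: "e > 0"
  shows "\<forall>\<^sub>F x in at_infinity. \<forall>\<omega>\<in>cball 0 R. norm (conv F (stft_window \<Phi> \<omega>) x) \<le> e"
proof -
  have C: "C \<ge> 0" using F(2)[of 0] norm_ge_zero order_trans by blast
  define L where "L = C * (2 * pi * L1_norm (\<lambda>y. of_real (norm y) * \<Phi> y))"
  have L: "L \<ge> 0" using C by (simp add: L_def)
  define d where "d = e / 2 / (L + 1)"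
  have d0: "d > 0" using e L by (simp add: d_def)
  have "L * d \<le> (L + 1) * d" using d0 by (intro mult_right_mono) auto
  also have "\<dots> = e / 2"
  proof -
    have "L + 1 \<noteq> 0" using L by linarith
    then show ?thesis unfolding d_def by (metis nonzero_mult_div_cancel_left times_divide_eq_right)
  qed
  finally have d: "d > 0" "L * d \<le> e / 2" using d0 by auto
  have "seq_compact (cball (0::'a) R)"
    by (rule compact_imp_seq_compact[OF compact_cball])
  then have "\<exists>k. finite k \<and> k \<subseteq> cball 0 R \<and> cball (0::'a) R \<subseteq> (\<Union>x\<in>k. ball x d)"
    using seq_compact_imp_totally_bounded d(1) by metis
  then obtain k where k: "finite k" "cball (0::'a) R \<subseteq> (\<Union>x\<in>k. ball x d)"
    by (elim exE conjE)
  have "\<forall>\<^sub>F x in at_infinity. \<forall>\<eta>\<in>k. norm (conv F (stft_window \<Phi> \<eta>) x) < e / 2"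
  proof (rule eventually_ball_finite[OF k(1)], rule ballI)
    fix \<eta>
    show "\<forall>\<^sub>F x in at_infinity. norm (conv F (stft_window \<Phi> \<eta>) x) < e / 2"
      using tendstoD[OF lim[of \<eta>], of "e/2"] e by simp
  qed
  then show ?thesis
  proof eventually_elim
    case (elim x)
    show ?case
    proof
      fix \<omega> :: 'a assume "\<omega> \<in> cball 0 R"
      then obtain \<eta> where \<eta>: "\<eta> \<in> k" "dist \<omega> \<eta> < d" using k(2) by (auto simp: dist_commute)
      have "norm (conv F (stft_window \<Phi> \<omega>) x - conv F (stft_window \<Phi> \<eta>) x)
         \<le> C * L1_norm (\<lambda>y. stft_window \<Phi> \<omega> y - stft_window \<Phi> \<eta> y)"
        by (intro norm_conv_diff_le[OF F] integrable_stft_window \<Phi>)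
      also have "\<dots> \<le> C * (2 * pi * dist \<omega> \<eta> * L1_norm (\<lambda>y. of_real (norm y) * \<Phi> y))"
        by (intro mult_left_mono stft_window_lipschitz \<Phi> C)
      also have "\<dots> = L * dist \<omega> \<eta>" by (simp add: L_def mult_ac)
      also have "\<dots> \<le> L * d" using \<eta> L by (intro mult_left_mono) auto
      finally have "norm (conv F (stft_window \<Phi> \<omega>) x - conv F (stft_window \<Phi> \<eta>) x) \<le> e / 2" using d by simp
      moreover have "norm (conv F (stft_window \<Phi> \<eta>) x) < e / 2" using elim \<eta> by blast
      ultimately show "norm (conv F (stft_window \<Phi> \<omega>) x) \<le> e"
        using norm_triangle_ineq[of "conv F (stft_window \<Phi> \<omega>) x - conv F (stft_window \<Phi> \<eta>) x" "conv F (stft_window \<Phi> \<eta>) x"]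
        by simp
    qed
  qed
qed

section \<open>The equivalence\<close>

text \<open>The symplectic form is the inner product composed with the rotation \<open>(x, \<omega>) \<mapsto> (\<omega>, - x)\<close>, so the symplectic
  Fourier transform is the ordinary one up to an invertible linear change of variable.\<close>

lemma symplectic_fourier_representative:
  fixes a :: "'d::finite phase_space \<Rightarrow> complex"
  assumes a': "a' \<in> borel_measurable borel" and ae: "AE x in lborel. a x = a' x"
  shows "symplectic_fourier a z = fourier a' ((2 * pi) *\<^sub>R (snd z, - fst z))"
proof -
  have s: "symplectic z z' = (snd z, - fst z) \<bullet> z'" for z'
    by (simp add: symplectic_def inner_prod_def inner_commute)
  have "AE z' in lborel. a z' * exp (- 2 * of_real pi * \<i> * of_real (symplectic z z'))
      = a' z' * cis (- (((2 * pi) *\<^sub>R (snd z, - fst z)) \<bullet> z'))"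
    using ae unfolding exp_minus_2pi s inner_scaleR_left by eventually_elim simp
  then show ?thesis
    unfolding symplectic_fourier_def fourier_def using a'
    by (intro lebesgue_integral_representative borel_measurable_times measurable_cis_minus_inner) auto
qed

theorem theorem4p4:
  fixes A :: complex and f :: "'d::finite phase_space \<Rightarrow> complex"
  assumes "f \<in> Linfty"
  shows "((\<exists>\<Phi> \<in> Schwartz. \<Phi> \<noteq> (\<lambda>_. 0) \<and>
            (\<forall>R>0. ((\<lambda>x. SUP \<omega>\<in>cball 0 R. norm (STFT \<Phi> (\<lambda>t. f t - A) x \<omega>)) \<longlongrightarrow> 0) at_infinity))
          \<longleftrightarrow>
          (\<exists>a \<in> Wiener_class. \<exists>h \<in> C0.
            \<forall>z. convolution f a z = A * (LINT z'|lebesgue. a z') + h z))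
         \<and>
         ((\<exists>a \<in> Wiener_class. \<exists>h \<in> C0.
            \<forall>z. convolution f a z = A * (LINT z'|lebesgue. a z') + h z)
          \<longleftrightarrow>
          (\<forall>g. integrable lebesgue g \<longrightarrow>
            (\<exists>h \<in> C0. \<forall>z. convolution f g z = A * (LINT z'|lebesgue. g z') + h z)))"
    (is "(?a \<longleftrightarrow> ?b) \<and> (?b \<longleftrightarrow> ?c)")
proof -
  obtain F C where F: "F \<in> borel_measurable borel" "\<And>x. norm (F x) \<le> C"
    and f: "AE x in lborel. f x - A = F x"
    using Linfty_representative[OF assms] by blast
  let ?all = "\<forall>g. integrable lborel g \<longrightarrow> g \<in> vanishing F"
  have all_iff_c: "?all \<longleftrightarrow> ?c"
  proof
    assume all: ?all
    show ?c
    proof (intro allI impI)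
      fix g :: "'d phase_space \<Rightarrow> complex" assume "integrable lebesgue g"
      then obtain G where G: "integrable lborel G" "AE x in lborel. g x = G x"
        by (rule integrable_representative)
      have "conv F G \<in> C0"
        using all G(1) continuous_conv[OF F G(1)] by (auto simp: C0_def vanishing_def)
      then show "\<exists>h \<in> C0. \<forall>z. convolution f g z = A * (LINT z'|lebesgue. g z') + h z"
        using convolution_representative[OF F f G] by blast
    qed
  next
    assume c: ?c
    show ?all
    proof (intro allI impI)
      fix G :: "'d phase_space \<Rightarrow> complex" assume G: "integrable lborel G"
      have "integrable lebesgue G"
        using G lebesgue_integrable_representative[of G G] by (simp add: integrable_iff_bounded)
      then obtain h where h: "h \<in> C0" "\<And>z. convolution f G z = A * (LINT z'|lebesgue. G z') + h z"
        using c by blast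
      have "conv F G = h"
        using h(2) convolution_representative[OF F f G, of G] by auto
      then show "G \<in> vanishing F" using h(1) G by (simp add: C0_def vanishing_def)
    qed
  qed
  have b_all: ?all if b: ?b
  proof -
    obtain a h where a: "a \<in> Wiener_class" and h: "h \<in> C0"
      and eq: "\<And>z. convolution f a z = A * (LINT z'|lebesgue. a z') + h z"
      using b by blast
    have "integrable lebesgue a" using a by (simp add: Wiener_class_def)
    then obtain a' where a': "integrable lborel a'" "AE x in lborel. a x = a' x"
      by (rule integrable_representative)
    have "conv F a' = h"
      using eq convolution_representative[OF F f a'] by auto
    then have van: "a' \<in> vanishing F" using h a' by (simp add: C0_def vanishing_def)
    have "fourier a' \<xi> \<noteq> 0" for \<xi>
    proof -
      (* inverts the rotation and scaling in symplectic_fourier_representative *)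
      define z where "z = (- (snd \<xi> /\<^sub>R (2 * pi)), fst \<xi> /\<^sub>R (2 * pi))"
      have "(2 * pi) *\<^sub>R (snd z, - fst z) = \<xi>"
        by (cases \<xi>) (simp add: z_def)
      then have "symplectic_fourier a z = fourier a' \<xi>"
        using symplectic_fourier_representative[OF _ a'(2), of z] a'(1) by (simp add: integrable_iff_bounded)
      then show ?thesis using a by (metis (mono_tags, lifting) Wiener_class_def mem_Collect_eq)
    qed
    then show ?all using vanishing_eq_L1[OF F] van by blast
  qed
  have all_b: ?b if ?all
  proof -
    have c: ?c using that all_iff_c by blast
    have gi: "integrable lborel (gaussian :: 'd phase_space \<Rightarrow> complex)"
      by (rule integrable_Schwartz[OF gaussian_Schwartz])
    then have gm: "(gaussian :: 'd phase_space \<Rightarrow> complex) \<in> borel_measurable borel"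
      by (simp add: integrable_iff_bounded)
    have gL: "integrable lebesgue (gaussian :: 'd phase_space \<Rightarrow> complex)"
      using gi lebesgue_integrable_representative[OF gm] by simp
    have "symplectic_fourier (gaussian :: 'd phase_space \<Rightarrow> complex) z \<noteq> 0" for z
      using symplectic_fourier_representative[OF gm AE_I2[OF refl], of z] fourier_gaussian_nonzero by metis
    then have "(gaussian :: 'd phase_space \<Rightarrow> complex) \<in> Wiener_class"
      using gL by (simp add: Wiener_class_def)
    with c gL show ?b by blast
  qed
  have a_all: ?all if a: ?a
  proof -
    obtain \<Phi> where \<Phi>: "\<Phi> \<in> Schwartz" "\<Phi> \<noteq> (\<lambda>_. 0)"
      and lim: "\<And>R. R > 0 \<Longrightarrow> ((\<lambda>x. SUP \<omega>\<in>cball 0 R. norm (STFT \<Phi> (\<lambda>t. f t - A) x \<omega>)) \<longlongrightarrow> 0) at_infinity"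
      using a by blast
    note \<Phi>c = Schwartz_continuous[OF \<Phi>(1)]
    have "stft_window \<Phi> \<omega> \<in> vanishing F" for \<omega>
    proof -
      let ?R = "norm \<omega> + 1"
      have bound: "norm (conv F (stft_window \<Phi> \<eta>) x) \<le> C * L1_norm (stft_window \<Phi> 0)" for \<eta> x
      proof -
        have "L1_norm (stft_window \<Phi> \<eta>) = L1_norm (stft_window \<Phi> 0)"
          by (simp add: L1_norm_def stft_window_def norm_mult)
        then show ?thesis using norm_conv_le[OF F integrable_stft_window[OF \<Phi>(1)], of \<eta> x] by simp
      qed
      have "norm (conv F (stft_window \<Phi> \<omega>) x) \<le> (SUP \<omega>\<in>cball 0 ?R. norm (STFT \<Phi> (\<lambda>t. f t - A) x \<omega>))" for x
        unfolding norm_STFT[OF F(1) f \<Phi>c]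
      proof (rule cSUP_upper)
        show "bdd_above ((\<lambda>\<eta>. norm (conv F (stft_window \<Phi> \<eta>) x)) ` cball 0 ?R)"
          by (rule bdd_aboveI2[OF bound])
      qed simp
      moreover have "((\<lambda>x. SUP \<omega>\<in>cball 0 ?R. norm (STFT \<Phi> (\<lambda>t. f t - A) x \<omega>)) \<longlongrightarrow> 0) at_infinity"
        by (rule lim) (simp add: add_nonneg_pos)
      ultimately have "(conv F (stft_window \<Phi> \<omega>) \<longlongrightarrow> 0) at_infinity"
        by (rule Lim_null_comparison[OF always_eventually[OF allI]])
      then show ?thesis using integrable_stft_window[OF \<Phi>(1)] by (simp add: vanishing_def)
    qed
    then show ?all using vanishing_eq_L1[OF F] fourier_stft_window_nonzero[OF \<Phi>] by blast
  qed
  have all_a: ?a if ?all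
  proof -
    let ?\<Phi> = "gaussian :: 'd phase_space \<Rightarrow> complex"
    have lim: "(conv F (stft_window ?\<Phi> \<omega>) \<longlongrightarrow> 0) at_infinity" for \<omega>
      using that integrable_stft_window[OF gaussian_Schwartz] by (auto simp: vanishing_def)
    have "((\<lambda>x. SUP \<omega>\<in>cball 0 R. norm (STFT ?\<Phi> (\<lambda>t. f t - A) x \<omega>)) \<longlongrightarrow> 0) at_infinity" if R: "R > 0" for R :: real
      unfolding norm_STFT[OF F(1) f Schwartz_continuous[OF gaussian_Schwartz]]
    proof (rule tendstoI)
      fix e :: real assume e: "e > 0"
      have "\<forall>\<^sub>F x in at_infinity. \<forall>\<omega>\<in>cball 0 R. norm (conv F (stft_window ?\<Phi> \<omega>) x) \<le> e / 2"
        using e by (intro conv_stft_window_uniform[OF F gaussian_Schwartz lim]) simp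
      then show "\<forall>\<^sub>F x in at_infinity. dist (SUP \<omega>\<in>cball 0 R. norm (conv F (stft_window ?\<Phi> \<omega>) x)) 0 < e"
      proof eventually_elim
        case (elim x)
        let ?s = "SUP \<omega>\<in>cball 0 R. norm (conv F (stft_window ?\<Phi> \<omega>) x)"
        have le: "?s \<le> e / 2" using elim R by (intro cSUP_least) auto
        have "norm (conv F (stft_window ?\<Phi> 0) x) \<le> ?s"
        proof (rule cSUP_upper)
          show "bdd_above ((\<lambda>\<omega>. norm (conv F (stft_window ?\<Phi> \<omega>) x)) ` cball 0 R)"
            by (rule bdd_aboveI2[of _ _ "e / 2"]) (use elim in blast)
        qed (use R in simp)
        then have "0 \<le> ?s" using norm_ge_zero order_trans by blast
        with le e show ?case by (simp add: dist_real_def)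
      qed
    qed
    moreover have "?\<Phi> \<noteq> (\<lambda>_. 0)" by (auto simp: gaussian_def fun_eq_iff)
    ultimately show ?a using gaussian_Schwartz by blast
  qed
  show ?thesis using all_iff_c b_all all_b a_all all_a by blast
qed

end
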